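(* For every implicative morphism $f:\mathcal A\to\mathcal B$ between modifiable arrow algebras, let $f^m:\mathcal A^m\to\mathcal B^m$ be the composite $$\mathcal A^m\xrightarrow{\ c\ }\mathcal A^{\to}\xrightarrow{\ f^{\to}\ }\mathcal B^{\to}\xrightarrow{\ \mathrm{id}_{B^{\to}}\ }\mathcal B^m.$$ Then $(-)^m$, given by $\mathcal A\mapsto\mathcal A^m$ and $f\mapsto f^m$, is a pseudofunctor $\mathsf{ArrAlg}_{\mathsf{mod}}\to\mathsf{ArrAlg}$. Moreover, if $f$ is computationally dense with right adjoint $h:\mathcal B\to\mathcal A$, then $f^m$ is computationally dense as well, and a right adjoint is given by $h^m:\mathcal B^m\to\mathcal A^m$. Furthermore, the square formed by $h^m:\mathcal B^m\to\mathcal A^m$, $c:\mathcal B^m\to\mathcal B^{\to}$, $c:\mathcal A^m\to\mathcal A^{\to}$ and $h^{\to}:\mathcal B^{\to}\to\mathcal A^{\to}$ commutes up to isomorphism, i.e. $c\circ h^m\dashv\vdash h^{\to}\circ c$ as implicative morphisms $\mathcal B^m\to\mathcal A^{\to}$.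
   Context: An arrow algebra $\mathcal A=(A,\preccurlyeq,\to,S)$ consists of a poset $(A,\preccurlyeq)$ with all meets (written $\bigwedge$, binary meets $\wedge$; top $\top$, bottom $\bot$); a binary operation $\to$ on $A$ (bracketed to the right), antitone in the first and monotone in the second argument; and a subset $S\subseteq A$ (the separator) which is upward closed, closed under modus ponens ($a\to b\in S$ and $a\in S$ imply $b\in S$), and contains the combinators $\mathbf k=\bigwedge_{a,b}a\to b\to a$, $\mathbf s=\bigwedge_{a,b,c}(a\to b\to c)\to(a\to b)\to a\to c$, and $\mathbf a=\bigwedge_{a,(b_i)_{i\in I},(c_i)_{i\in I}}\big(\bigwedge_{i\in I}a\to b_i\to c_i\big)\to a\to\bigwedge_{i\in I}(b_i\to c_i)$. The logical order is $a\vdash b$ iff $a\to b\in S$; it makes $A$ a Heyting prealgebra. Put $\partial a=\top\to a$. An implicative morphism $f:\mathcal A\to\mathcal B$ is a function $f:A\to B$ such that: (i) $f(a)\in S_B$ for every $a\in S_A$; (ii) there is $r\in S_B$ with $r\preccurlyeq f(a\to a')\to f(a)\to f(a')$ for all $a,a'\in A$; (iii) for every $X\subseteq A\times A$, if $\bigwedge_{(a,a')\in X}a\to a'\in S_A$ then $\bigwedge_{(a,a')\in X}f(a)\to f(a')\in S_B$. Write $f\vdash f'$ if $\bigwedge_{a\in A}f(a)\to f'(a)\in S_B$, and $f\dashv\vdash f'$ for both directions. $\mathsf{ArrAlg}$ is the resulting preorder-enriched category. $f:\mathcal A\to\mathcal B$ is computationally dense if it has a right adjoint, i.e. an implicative morphism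 $h:\mathcal B\to\mathcal A$ with $fh\vdash\mathrm{id}_B$ and $\mathrm{id}_A\vdash hf$. $\mathcal A$ is binary implicative if $a\to(b\wedge c)=(a\to b)\wedge(a\to c)$ for all $a,b,c$, and modifiable if moreover $\bot\to a=\top$ for all $a$; $\mathsf{ArrAlg}_{\mathsf{mod}}$ is the full subcategory of $\mathsf{ArrAlg}$ on modifiable arrow algebras. For $\mathcal A$ binary implicative, $\mathcal A^{\to}=(A^{\to},\preccurlyeq,\to,S^{\to})$ is the arrow algebra with $A^{\to}=\{(x_0,x_1)\in A\times A:x_0\preccurlyeq x_1\}$, pointwise order, $x\to y=\big((x_0\to y_0)\wedge(x_1\to y_1),\,x_1\to y_1\big)$, and $S^{\to}=\{x\in A^{\to}:x_0\in S\}$. For an implicative morphism $f:\mathcal A\to\mathcal B$ of binary implicative arrow algebras, $f^{\to}:\mathcal A^{\to}\to\mathcal B^{\to}$ is the implicative morphism $f^{\to}(x_0,x_1)=\big(\bigwedge_{x_0\preccurlyeq a}\partial f(a),\bigwedge_{x_1\preccurlyeq a}\partial f(a)\big)$. A nucleus on an arrow algebra $\mathcal A$ is a function $j:A\to A$ such that: (i) $a\preccurlyeq b$ implies $ja\preccurlyeq jb$; (ii) $\bigwedge_{a\in A}a\to ja\in S$; (iii) $\bigwedge_{a,b\in A}(a\to jb)\to ja\to jb\in S$. It determines the arrow algebra $\mathcal A_j=(A,\preccurlyeq,\to_j,S_j)$ with $a\to_jb=a\to jb$, $S_j=\{a:ja\in S\}$; $\mathrm{id}_A:\mathcal A\to\mathcal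 A_j$ and $j:\mathcal A_j\to\mathcal A$ are implicative morphisms. For $\mathcal A$ modifiable, its modification is $\mathcal A^m=(\mathcal A^{\to})_c$ where $c$ is the nucleus $c(x)=x\vee(\bot,\top)$ on $\mathcal A^{\to}$, $\vee$ being the logical join (join for $\vdash$) in $\mathcal A^{\to}$; concretely one may take $x\vee y=\bigwedge_z(x\to z)\to(y\to z)\to z$. The same letter $c$ is used for this nucleus on $\mathcal A^{\to}$ and on $\mathcal B^{\to}$. A pseudofunctor between preorder-enriched categories preserves the order on morphisms, and preserves identities and composition up to isomorphism. *)

theory Defs
  imports "HOL-Algebra.Complete_Lattice"
begin

section \<open>Preorder-enriched categories and pseudofunctors\<close>

text \<open>
  A morphism value does not carry its domain and codomain, so identities, composition and the
  order on morphisms take the objects as arguments; in \<open>Comp C a b c g f\<close> we have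
  \<open>f : a \<rightarrow> b\<close> and \<open>g : b \<rightarrow> c\<close>.
\<close>

record ('o, 'm) pre_cat =
  Obj :: "'o set"
  Hom :: "'o \<Rightarrow> 'o \<Rightarrow> 'm set"
  Hom_le :: "'o \<Rightarrow> 'o \<Rightarrow> 'm \<Rightarrow> 'm \<Rightarrow> bool"
  Idt :: "'o \<Rightarrow> 'm"
  Comp :: "'o \<Rightarrow> 'o \<Rightarrow> 'o \<Rightarrow> 'm \<Rightarrow> 'm \<Rightarrow> 'm"

locale preorder_category =
  fixes C :: "('o, 'm) pre_cat"
  assumes id_hom: "a \<in> Obj C \<Longrightarrow> Idt C a \<in> Hom C a a"
    and comp_hom: "\<lbrakk>a \<in> Obj C; b \<in> Obj C; c \<in> Obj C; f \<in> Hom C a b; g \<in> Hom C b c\<rbrakk>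
      \<Longrightarrow> Comp C a b c g f \<in> Hom C a c"
    and id_left: "\<lbrakk>a \<in> Obj C; b \<in> Obj C; f \<in> Hom C a b\<rbrakk> \<Longrightarrow> Comp C a b b (Idt C b) f = f"
    and id_right: "\<lbrakk>a \<in> Obj C; b \<in> Obj C; f \<in> Hom C a b\<rbrakk> \<Longrightarrow> Comp C a a b f (Idt C a) = f"
    and comp_assoc: "\<lbrakk>a \<in> Obj C; b \<in> Obj C; c \<in> Obj C; d \<in> Obj C;
        f \<in> Hom C a b; g \<in> Hom C b c; h \<in> Hom C c d\<rbrakk>
      \<Longrightarrow> Comp C a c d h (Comp C a b c g f) = Comp C a b d (Comp C b c d h g) f"
    and hom_le_refl: "\<lbrakk>a \<in> Obj C; b \<in> Obj C; f \<in> Hom C a b\<rbrakk> \<Longrightarrow> Hom_le C a b f f"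
    and hom_le_trans: "\<lbrakk>a \<in> Obj C; b \<in> Obj C; f \<in> Hom C a b; f' \<in> Hom C a b; f'' \<in> Hom C a b;
        Hom_le C a b f f'; Hom_le C a b f' f''\<rbrakk> \<Longrightarrow> Hom_le C a b f f''"
    and comp_mono: "\<lbrakk>a \<in> Obj C; b \<in> Obj C; c \<in> Obj C;
        f \<in> Hom C a b; f' \<in> Hom C a b; g \<in> Hom C b c; g' \<in> Hom C b c;
        Hom_le C a b f f'; Hom_le C b c g g'\<rbrakk>
      \<Longrightarrow> Hom_le C a c (Comp C a b c g f) (Comp C a b c g' f')"

definition hom_iso :: "('o, 'm) pre_cat \<Rightarrow> 'o \<Rightarrow> 'o \<Rightarrow> 'm \<Rightarrow> 'm \<Rightarrow> bool" where
  "hom_iso C a b f g \<longleftrightarrow> Hom_le C a b f g \<and> Hom_le C a b g f"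

definition full_subcategory :: "('o, 'm) pre_cat \<Rightarrow> ('o \<Rightarrow> bool) \<Rightarrow> ('o, 'm) pre_cat" where
  "full_subcategory C P = C\<lparr>Obj := {a \<in> Obj C. P a}\<rparr>"

locale pseudofunctor = src: preorder_category C + tgt: preorder_category D
  for C :: "('o, 'm) pre_cat" and D :: "('p, 'n) pre_cat" +
  fixes F :: "'o \<Rightarrow> 'p" and G :: "'o \<Rightarrow> 'o \<Rightarrow> 'm \<Rightarrow> 'n"
  assumes obj_map: "a \<in> Obj C \<Longrightarrow> F a \<in> Obj D"
    and hom_map: "\<lbrakk>a \<in> Obj C; b \<in> Obj C; f \<in> Hom C a b\<rbrakk> \<Longrightarrow> G a b f \<in> Hom D (F a) (F b)"
    and map_mono: "\<lbrakk>a \<in> Obj C; b \<in> Obj C; f \<in> Hom C a b; f' \<in> Hom C a b; Hom_le C a b f f'\<rbrakk>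
      \<Longrightarrow> Hom_le D (F a) (F b) (G a b f) (G a b f')"
    and map_id: "a \<in> Obj C \<Longrightarrow> hom_iso D (F a) (F a) (G a a (Idt C a)) (Idt D (F a))"
    and map_comp: "\<lbrakk>a \<in> Obj C; b \<in> Obj C; c \<in> Obj C; f \<in> Hom C a b; g \<in> Hom C b c\<rbrakk>
      \<Longrightarrow> hom_iso D (F a) (F c) (G a c (Comp C a b c g f))
            (Comp D (F a) (F b) (F c) (G b c g) (G a b f))"


section \<open>Arrow algebras\<close>

record 'a arrow_alg = "'a gorder" +
  imp :: "'a \<Rightarrow> 'a \<Rightarrow> 'a" (infixr \<open>\<leadsto>\<index>\<close> 60)
  sep :: "'a set"

definition comb_k :: "'a arrow_alg \<Rightarrow> 'a" where
  "comb_k A = \<Sqinter>\<^bsub>A\<^esub>{a \<leadsto>\<^bsub>A\<^esub> b \<leadsto>\<^bsub>A\<^esub> a | a b. a \<in> carrier A \<and> b \<in> carrier A}"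

definition comb_s :: "'a arrow_alg \<Rightarrow> 'a" where
  "comb_s A = \<Sqinter>\<^bsub>A\<^esub>{(a \<leadsto>\<^bsub>A\<^esub> b \<leadsto>\<^bsub>A\<^esub> c) \<leadsto>\<^bsub>A\<^esub> (a \<leadsto>\<^bsub>A\<^esub> b) \<leadsto>\<^bsub>A\<^esub> a \<leadsto>\<^bsub>A\<^esub> c | a b c.
     a \<in> carrier A \<and> b \<in> carrier A \<and> c \<in> carrier A}"

text \<open>
  The combinator \<open>a\<close> is a meet over all \<open>I\<close>-indexed families of pairs \<open>(b\<^sub>i, c\<^sub>i)\<close>, for
  all sets \<open>I\<close>. Each member of that meet depends only on the set
  \<open>X = {(b\<^sub>i, c\<^sub>i) | i \<in> I}\<close>, and every set of pairs arises in this way, so \<open>X\<close>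
  (possibly empty) replaces the family.
\<close>

definition comb_a :: "'a arrow_alg \<Rightarrow> 'a" where
  "comb_a A = \<Sqinter>\<^bsub>A\<^esub>{(\<Sqinter>\<^bsub>A\<^esub>{a \<leadsto>\<^bsub>A\<^esub> b \<leadsto>\<^bsub>A\<^esub> c | b c. (b, c) \<in> X})
       \<leadsto>\<^bsub>A\<^esub> a \<leadsto>\<^bsub>A\<^esub> (\<Sqinter>\<^bsub>A\<^esub>{b \<leadsto>\<^bsub>A\<^esub> c | b c. (b, c) \<in> X}) | a X.
     a \<in> carrier A \<and> X \<subseteq> carrier A \<times> carrier A}"

locale arrow_algebra = partial_order A for A :: "'a arrow_alg" (structure) +
  assumes inf_exists: "X \<subseteq> carrier A \<Longrightarrow> \<exists>i. greatest A i (Lower A X)"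
    and imp_closed: "\<lbrakk>a \<in> carrier A; b \<in> carrier A\<rbrakk> \<Longrightarrow> a \<leadsto> b \<in> carrier A"
    and imp_mono: "\<lbrakk>a \<in> carrier A; a' \<in> carrier A; b \<in> carrier A; b' \<in> carrier A;
        a' \<sqsubseteq> a; b \<sqsubseteq> b'\<rbrakk> \<Longrightarrow> a \<leadsto> b \<sqsubseteq> a' \<leadsto> b'"
    and sep_subset: "sep A \<subseteq> carrier A"
    and sep_upward: "\<lbrakk>a \<in> sep A; b \<in> carrier A; a \<sqsubseteq> b\<rbrakk> \<Longrightarrow> b \<in> sep A"
    and sep_mp: "\<lbrakk>a \<in> carrier A; b \<in> carrier A; a \<leadsto> b \<in> sep A; a \<in> sep A\<rbrakk> \<Longrightarrow> b \<in> sep A"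
    and sep_k: "comb_k A \<in> sep A"
    and sep_s: "comb_s A \<in> sep A"
    and sep_a: "comb_a A \<in> sep A"

definition delta :: "'a arrow_alg \<Rightarrow> 'a \<Rightarrow> 'a" where
  "delta A a = \<top>\<^bsub>A\<^esub> \<leadsto>\<^bsub>A\<^esub> a"

locale binary_implicative = arrow_algebra +
  assumes imp_meet: "\<lbrakk>a \<in> carrier A; b \<in> carrier A; c \<in> carrier A\<rbrakk>
    \<Longrightarrow> a \<leadsto> (b \<sqinter> c) = (a \<leadsto> b) \<sqinter> (a \<leadsto> c)"

locale modifiable = binary_implicative +
  assumes bottom_imp: "a \<in> carrier A \<Longrightarrow> \<bottom> \<leadsto> a = \<top>"


section \<open>Implicative morphisms\<close>

text \<open>
  Morphisms are extensional functions (\<open>undefined\<close> off the carrier of the domain), so that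
  equality of morphisms is equality of functions on the carrier.
\<close>

locale implicative_morphism = A: arrow_algebra A + B: arrow_algebra B
  for A :: "'a arrow_alg" and B :: "'b arrow_alg" +
  fixes f :: "'a \<Rightarrow> 'b"
  assumes map_carrier: "f \<in> carrier A \<rightarrow>\<^sub>E carrier B"
    and map_sep: "a \<in> sep A \<Longrightarrow> f a \<in> sep B"
    and map_imp: "\<exists>r \<in> sep B. \<forall>a \<in> carrier A. \<forall>a' \<in> carrier A.
      r \<sqsubseteq>\<^bsub>B\<^esub> f (a \<leadsto>\<^bsub>A\<^esub> a') \<leadsto>\<^bsub>B\<^esub> f a \<leadsto>\<^bsub>B\<^esub> f a'"
    and map_uniform: "\<lbrakk>X \<subseteq> carrier A \<times> carrier A;
        \<Sqinter>\<^bsub>A\<^esub>{a \<leadsto>\<^bsub>A\<^esub> a' | a a'. (a, a') \<in> X} \<in> sep A\<rbrakk>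
      \<Longrightarrow> \<Sqinter>\<^bsub>B\<^esub>{f a \<leadsto>\<^bsub>B\<^esub> f a' | a a'. (a, a') \<in> X} \<in> sep B"

definition mor_le :: "'a arrow_alg \<Rightarrow> 'b arrow_alg \<Rightarrow> ('a \<Rightarrow> 'b) \<Rightarrow> ('a \<Rightarrow> 'b) \<Rightarrow> bool" where
  "mor_le A B f f' \<longleftrightarrow> \<Sqinter>\<^bsub>B\<^esub>{f a \<leadsto>\<^bsub>B\<^esub> f' a | a. a \<in> carrier A} \<in> sep B"

definition mor_iso :: "'a arrow_alg \<Rightarrow> 'b arrow_alg \<Rightarrow> ('a \<Rightarrow> 'b) \<Rightarrow> ('a \<Rightarrow> 'b) \<Rightarrow> bool" where
  "mor_iso A B f f' \<longleftrightarrow> implicative_morphism A B f \<and> implicative_morphism A B f' \<and>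
     mor_le A B f f' \<and> mor_le A B f' f"

definition id_mor :: "'a arrow_alg \<Rightarrow> 'a \<Rightarrow> 'a" where
  "id_mor A = (\<lambda>a \<in> carrier A. a)"

definition right_adjoint ::
    "'a arrow_alg \<Rightarrow> 'b arrow_alg \<Rightarrow> ('a \<Rightarrow> 'b) \<Rightarrow> ('b \<Rightarrow> 'a) \<Rightarrow> bool" where
  "right_adjoint A B f h \<longleftrightarrow> implicative_morphism B A h \<and>
     mor_le B B (compose (carrier B) f h) (id_mor B) \<and>
     mor_le A A (id_mor A) (compose (carrier A) h f)"

definition computationally_dense :: "'a arrow_alg \<Rightarrow> 'b arrow_alg \<Rightarrow> ('a \<Rightarrow> 'b) \<Rightarrow> bool" where
  "computationally_dense A B f \<longleftrightarrow>
     implicative_morphism A B f \<and> (\<exists>h. right_adjoint A B f h)"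

text \<open>
  The category of arrow algebras whose underlying sets are subsets of the type \<open>'u\<close>. This
  arbitrary type plays the role of the universe of sets; \<open>\<lambda>A. A\<^sup>m\<close> moves from \<open>'u\<close>
  to \<open>'u \<times> 'u\<close>.
\<close>

definition ArrAlg :: "('u arrow_alg, 'u \<Rightarrow> 'u) pre_cat" where
  "ArrAlg = \<lparr>
     Obj = {A. arrow_algebra A},
     Hom = (\<lambda>A B. {f. implicative_morphism A B f}),
     Hom_le = mor_le,
     Idt = id_mor,
     Comp = (\<lambda>A B C g f. compose (carrier A) g f)\<rparr>"

definition ArrAlg_mod :: "('u arrow_alg, 'u \<Rightarrow> 'u) pre_cat" where
  "ArrAlg_mod = full_subcategory ArrAlg modifiable"


section \<open>The arrow construction and the modification\<close>

definition arrow_of :: "'a arrow_alg \<Rightarrow> ('a \<times> 'a) arrow_alg" where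
  "arrow_of A = \<lparr>
     carrier = {(x0, x1). x0 \<in> carrier A \<and> x1 \<in> carrier A \<and> x0 \<sqsubseteq>\<^bsub>A\<^esub> x1},
     eq = (=),
     le = (\<lambda>(x0, x1) (y0, y1). x0 \<sqsubseteq>\<^bsub>A\<^esub> y0 \<and> x1 \<sqsubseteq>\<^bsub>A\<^esub> y1),
     imp = (\<lambda>(x0, x1) (y0, y1).
       ((x0 \<leadsto>\<^bsub>A\<^esub> y0) \<sqinter>\<^bsub>A\<^esub> (x1 \<leadsto>\<^bsub>A\<^esub> y1), x1 \<leadsto>\<^bsub>A\<^esub> y1)),
     sep = {(x0, x1). x0 \<in> sep A \<and> x1 \<in> carrier A \<and> x0 \<sqsubseteq>\<^bsub>A\<^esub> x1}\<rparr>"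

definition arrow_mor :: "'a arrow_alg \<Rightarrow> 'b arrow_alg \<Rightarrow> ('a \<Rightarrow> 'b) \<Rightarrow> ('a \<times> 'a \<Rightarrow> 'b \<times> 'b)" where
  "arrow_mor A B f = (\<lambda>(x0, x1) \<in> carrier (arrow_of A).
     (\<Sqinter>\<^bsub>B\<^esub>{delta B (f a) | a. a \<in> carrier A \<and> x0 \<sqsubseteq>\<^bsub>A\<^esub> a},
      \<Sqinter>\<^bsub>B\<^esub>{delta B (f a) | a. a \<in> carrier A \<and> x1 \<sqsubseteq>\<^bsub>A\<^esub> a}))"

definition nucleus_alg :: "'a arrow_alg \<Rightarrow> ('a \<Rightarrow> 'a) \<Rightarrow> 'a arrow_alg" where
  "nucleus_alg A j = A\<lparr>
     imp := (\<lambda>a b. a \<leadsto>\<^bsub>A\<^esub> j b),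
     sep := {a \<in> carrier A. j a \<in> sep A}\<rparr>"

text \<open>
  A join for the logical order, given by its second-order encoding. Any other logical join is
  logically equivalent to this one.
\<close>

definition log_join :: "'a arrow_alg \<Rightarrow> 'a \<Rightarrow> 'a \<Rightarrow> 'a" where
  "log_join A x y =
     \<Sqinter>\<^bsub>A\<^esub>{(x \<leadsto>\<^bsub>A\<^esub> z) \<leadsto>\<^bsub>A\<^esub> (y \<leadsto>\<^bsub>A\<^esub> z) \<leadsto>\<^bsub>A\<^esub> z | z. z \<in> carrier A}"

definition c_nucleus :: "'a arrow_alg \<Rightarrow> 'a \<times> 'a \<Rightarrow> 'a \<times> 'a" where
  "c_nucleus A = (\<lambda>x \<in> carrier (arrow_of A). log_join (arrow_of A) x (\<bottom>\<^bsub>A\<^esub>, \<top>\<^bsub>A\<^esub>))"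

definition modif :: "'a arrow_alg \<Rightarrow> ('a \<times> 'a) arrow_alg" where
  "modif A = nucleus_alg (arrow_of A) (c_nucleus A)"

definition modif_mor :: "'a arrow_alg \<Rightarrow> 'b arrow_alg \<Rightarrow> ('a \<Rightarrow> 'b) \<Rightarrow> ('a \<times> 'a \<Rightarrow> 'b \<times> 'b)" where
  "modif_mor A B f =
     compose (carrier (modif A)) (id_mor (arrow_of B))
       (compose (carrier (modif A)) (arrow_mor A B f) (c_nucleus A))"

end

theory Submission
  imports Defs
begin

text \<open>
  An arrow algebra \<open>A\<close> defines an entailment between families \<open>\<phi>, \<psi> : I \<rightarrow> A\<close> for every index set
  \<open>I\<close>: \<open>\<phi> \<turnstile> \<psi>\<close> if a single element of the separator lies below all \<open>\<phi> i \<leadsto> \<psi> i\<close>. Each of these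
  preorders satisfies the rules of intuitionistic implication, and an implicative morphism is a map
  that preserves entailments, the separator, and implications up to \<open>f (a \<leadsto> b) \<turnstile> f a \<leadsto> f b\<close>. All of
  the argument takes place in these preorders, after three translations. Entailment \<open>\<phi> \<turnstile> \<psi>\<close> in \<open>A\<^sub>j\<close>
  is \<open>\<phi> \<turnstile> j \<psi>\<close> in \<open>A\<close> (\<open>entails_nucleus_alg\<close>). Entailment in \<open>A\<^sup>\<rightarrow>\<close> is entailment in \<open>A\<close> over an
  index set with two copies of each index, one for each component (\<open>entails_Arr\<close>). Up to
  isomorphism \<open>f\<^sup>\<rightarrow>\<close> applies \<open>f\<close> to both components (\<open>entails_hull\<close>, \<open>hull_entails\<close>), which makes
  \<open>f \<mapsto> f\<^sup>\<rightarrow>\<close> monotone and functorial up to isomorphism.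

  The point of the theorem is that an implicative morphism does not have to preserve joins, so that
  \<open>f\<^sup>\<rightarrow>\<close> has no evident reason to be compatible with \<open>c x = x \<or> (\<bottom>, \<top>)\<close>. But \<open>c\<close> fixes, up to
  isomorphism, all \<open>x\<close> with \<open>(\<bottom>, \<top>) \<turnstile> x\<close>, and \<open>c x\<close> itself is of this kind. In a modifiable algebra
  \<open>(\<bottom>, \<top>) \<turnstile> x\<close> only says that the upper component of \<open>x\<close> is valid (\<open>bottom_top_entails_iff\<close>), and
  implicative morphisms preserve validity. Hence \<open>c f\<^sup>\<rightarrow> c \<cong> f\<^sup>\<rightarrow> c\<close> (\<open>c_arr_c\<close>). This is the
  commuting square, and it deletes the inner \<open>c\<close> in \<open>g\<^sup>m f\<^sup>m = g\<^sup>\<rightarrow> c f\<^sup>\<rightarrow> c \<cong> (g f)\<^sup>\<rightarrow> c = (g f)\<^sup>m\<close>. A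
  monotone assignment that preserves identities and composites up to isomorphism carries adjunctions
  to adjunctions, which gives the right adjoint.
\<close>

section \<open>Uniform entailment in an arrow algebra\<close>

sublocale arrow_algebra \<subseteq> complete_lattice A
proof (rule complete_lattice_criterion1)
  have "Lower A {} = carrier A"
    by (auto simp: Lower_def)
  then show "\<exists>g. greatest A g (carrier A)"
    using inf_exists [of "{}"] by simp
qed (rule inf_exists)

lemma Setcompr_pairs: "{f a b | a b. (a, b) \<in> X} = (\<lambda>x. f (fst x) (snd x)) ` X"
  by (auto intro: rev_image_eqI) blast

text \<open>
  Asking for a common realizer, and not for \<open>\<Sqinter>{\<phi> i \<leadsto> \<psi> i | i \<in> I}\<close> in the separator, makes
  reindexing hold with no closure conditions on the families. The two agree for families in the
  carrier, see \<open>entails_iff_Inf\<close>.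
\<close>

definition entails :: "'a arrow_alg \<Rightarrow> 'i set \<Rightarrow> ('i \<Rightarrow> 'a) \<Rightarrow> ('i \<Rightarrow> 'a) \<Rightarrow> bool" where
  "entails A I \<phi> \<psi> \<longleftrightarrow> (\<exists>r \<in> sep A. \<forall>i \<in> I. r \<sqsubseteq>\<^bsub>A\<^esub> \<phi> i \<leadsto>\<^bsub>A\<^esub> \<psi> i)"

lemma entails_reindex:
  "entails A I \<phi> \<psi> \<Longrightarrow> h \<in> J \<rightarrow> I \<Longrightarrow> entails A J (\<lambda>j. \<phi> (h j)) (\<lambda>j. \<psi> (h j))"
  unfolding entails_def by fast

lemma entails_cong:
  "entails A I \<phi> \<psi> \<Longrightarrow> (\<And>i. i \<in> I \<Longrightarrow> \<phi> i = \<phi>' i) \<Longrightarrow> (\<And>i. i \<in> I \<Longrightarrow> \<psi> i = \<psi>' i)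
    \<Longrightarrow> entails A I \<phi>' \<psi>'"
  unfolding entails_def by auto

context arrow_algebra
begin

lemma sep_closed [simp]: "a \<in> sep A \<Longrightarrow> a \<in> carrier A"
  using sep_subset by blast

declare imp_closed [simp]

lemma imp_Pi [simp]:
  "\<phi> \<in> I \<rightarrow> carrier A \<Longrightarrow> \<psi> \<in> I \<rightarrow> carrier A \<Longrightarrow> (\<lambda>i. \<phi> i \<leadsto> \<psi> i) \<in> I \<rightarrow> carrier A"
  by (simp add: Pi_iff)

lemma top_sep: "\<top> \<in> sep A"
  by (rule sep_upward [OF sep_k]) (simp_all add: sep_k)

lemma Inf_sep:
  assumes "r \<in> sep A" "X \<subseteq> carrier A" "\<And>x. x \<in> X \<Longrightarrow> r \<sqsubseteq> x"
  shows "\<Sqinter>X \<in> sep A"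
  using assms sep_upward [OF assms(1)] inf_greatest by simp

lemma entails_iff_Inf:
  assumes "\<phi> \<in> I \<rightarrow> carrier A" "\<psi> \<in> I \<rightarrow> carrier A"
  shows "entails A I \<phi> \<psi> \<longleftrightarrow> \<Sqinter>((\<lambda>i. \<phi> i \<leadsto> \<psi> i) ` I) \<in> sep A"
proof
  have sub: "(\<lambda>i. \<phi> i \<leadsto> \<psi> i) ` I \<subseteq> carrier A"
    using assms by (auto simp: Pi_iff)
  show "\<Sqinter>((\<lambda>i. \<phi> i \<leadsto> \<psi> i) ` I) \<in> sep A" if "entails A I \<phi> \<psi>"
    using that Inf_sep [OF _ sub] unfolding entails_def by blast
  show "entails A I \<phi> \<psi>" if "\<Sqinter>((\<lambda>i. \<phi> i \<leadsto> \<psi> i) ` I) \<in> sep A"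
    using that inf_lower [OF sub] unfolding entails_def by blast
qed

lemma comb_k_le: "a \<in> carrier A \<Longrightarrow> b \<in> carrier A \<Longrightarrow> comb_k A \<sqsubseteq> a \<leadsto> b \<leadsto> a"
  unfolding comb_k_def by (rule inf_lower) auto

lemma comb_s_le:
  "a \<in> carrier A \<Longrightarrow> b \<in> carrier A \<Longrightarrow> c \<in> carrier A
    \<Longrightarrow> comb_s A \<sqsubseteq> (a \<leadsto> b \<leadsto> c) \<leadsto> (a \<leadsto> b) \<leadsto> a \<leadsto> c"
  unfolding comb_s_def by (rule inf_lower) auto

lemma pair_Inf_closed [simp]:
  assumes "X \<subseteq> carrier A \<times> carrier A"
  shows "\<Sqinter>{b \<leadsto> c | b c. (b, c) \<in> X} \<in> carrier A"
    "a \<in> carrier A \<Longrightarrow> \<Sqinter>{a \<leadsto> b \<leadsto> c | b c. (b, c) \<in> X} \<in> carrier A"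
  using assms by (auto intro!: inf_closed)

lemma comb_a_le_pairs:
  "a \<in> carrier A \<Longrightarrow> X \<subseteq> carrier A \<times> carrier A
    \<Longrightarrow> comb_a A \<sqsubseteq> \<Sqinter>{a \<leadsto> b \<leadsto> c | b c. (b, c) \<in> X} \<leadsto> a \<leadsto> \<Sqinter>{b \<leadsto> c | b c. (b, c) \<in> X}"
  unfolding comb_a_def by (rule inf_lower) auto

lemma comb_a_le:
  assumes "a \<in> carrier A" "\<psi> \<in> I \<rightarrow> carrier A" "\<chi> \<in> I \<rightarrow> carrier A"
  shows "comb_a A \<sqsubseteq> \<Sqinter>((\<lambda>i. a \<leadsto> \<psi> i \<leadsto> \<chi> i) ` I) \<leadsto> a \<leadsto> \<Sqinter>((\<lambda>i. \<psi> i \<leadsto> \<chi> i) ` I)"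
proof -
  let ?X = "(\<lambda>i. (\<psi> i, \<chi> i)) ` I"
  have "{a \<leadsto> b \<leadsto> c | b c. (b, c) \<in> ?X} = (\<lambda>i. a \<leadsto> \<psi> i \<leadsto> \<chi> i) ` I"
    "{b \<leadsto> c | b c. (b, c) \<in> ?X} = (\<lambda>i. \<psi> i \<leadsto> \<chi> i) ` I"
    by auto
  then show ?thesis
    using comb_a_le_pairs [of a ?X] assms by (simp add: Pi_iff image_subset_iff)
qed

text \<open>
  In an arrow algebra \<open>a \<leadsto> \<Sqinter>X\<close> may lie strictly below \<open>\<Sqinter>{a \<leadsto> x | x \<in> X}\<close>, so modus ponens with
  \<open>a\<close> and the latter does not put \<open>\<Sqinter>X\<close> into the separator. The combinator \<open>comb_a A\<close> repairs this
  when the members of \<open>X\<close> are implications. For this reason every uniform statement below is kept in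
  the form of an entailment.
\<close>

lemma entails_mp_sep:
  assumes "t \<in> sep A" "entails A I (\<lambda>_. t) (\<lambda>i. \<psi> i \<leadsto> \<chi> i)"
    and c: "\<psi> \<in> I \<rightarrow> carrier A" "\<chi> \<in> I \<rightarrow> carrier A"
  shows "entails A I \<psi> \<chi>"
proof -
  let ?U = "\<Sqinter>((\<lambda>i. t \<leadsto> \<psi> i \<leadsto> \<chi> i) ` I)" and ?W = "\<Sqinter>((\<lambda>i. \<psi> i \<leadsto> \<chi> i) ` I)"
  have closed: "?U \<in> carrier A" "?W \<in> carrier A"
    using assms by (auto intro!: inf_closed simp: Pi_iff)
  have U: "?U \<in> sep A"
    using assms by (auto simp: entails_iff_Inf)
  have "?U \<leadsto> t \<leadsto> ?W \<in> sep A"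
    by (rule sep_upward [OF sep_a _ comb_a_le]) (use closed assms in auto)
  then have "?W \<in> sep A"
    using U closed assms(1) sep_mp by (meson imp_closed sep_closed)
  then show ?thesis
    using c by (simp add: entails_iff_Inf)
qed

lemma entails_mp:
  assumes *: "entails A I (\<lambda>i. \<alpha> i \<leadsto> \<beta> i) (\<lambda>i. \<psi> i \<leadsto> \<chi> i)" "entails A I \<alpha> \<beta>"
    and c: "\<alpha> \<in> I \<rightarrow> carrier A" "\<beta> \<in> I \<rightarrow> carrier A" "\<psi> \<in> I \<rightarrow> carrier A" "\<chi> \<in> I \<rightarrow> carrier A"
  shows "entails A I \<psi> \<chi>"
proof -
  obtain t where t: "t \<in> sep A" "\<forall>i \<in> I. t \<sqsubseteq> \<alpha> i \<leadsto> \<beta> i"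
    using * unfolding entails_def by blast
  obtain r where r: "r \<in> sep A" "\<forall>i \<in> I. r \<sqsubseteq> (\<alpha> i \<leadsto> \<beta> i) \<leadsto> \<psi> i \<leadsto> \<chi> i"
    using * unfolding entails_def by blast
  have "r \<sqsubseteq> t \<leadsto> \<psi> i \<leadsto> \<chi> i" if i: "i \<in> I" for i
  proof (rule le_trans)
    show "r \<sqsubseteq> (\<alpha> i \<leadsto> \<beta> i) \<leadsto> \<psi> i \<leadsto> \<chi> i"
      using r i by blast
    show "(\<alpha> i \<leadsto> \<beta> i) \<leadsto> \<psi> i \<leadsto> \<chi> i \<sqsubseteq> t \<leadsto> \<psi> i \<leadsto> \<chi> i"
      using t c i by (intro imp_mono) (auto simp: Pi_iff)
  qed (use r t c i in \<open>auto simp: Pi_iff\<close>)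
  then have "entails A I (\<lambda>_. t) (\<lambda>i. \<psi> i \<leadsto> \<chi> i)"
    using r unfolding entails_def by blast
  with t(1) c show ?thesis
    by (rule_tac entails_mp_sep)
qed

lemma entails_k:
  "\<phi> \<in> I \<rightarrow> carrier A \<Longrightarrow> \<psi> \<in> I \<rightarrow> carrier A \<Longrightarrow> entails A I \<phi> (\<lambda>i. \<psi> i \<leadsto> \<phi> i)"
  unfolding entails_def by (rule bexI [OF _ sep_k]) (auto simp: Pi_iff intro: comb_k_le)

lemma entails_s:
  "\<phi> \<in> I \<rightarrow> carrier A \<Longrightarrow> \<psi> \<in> I \<rightarrow> carrier A \<Longrightarrow> \<chi> \<in> I \<rightarrow> carrier A
    \<Longrightarrow> entails A I (\<lambda>i. \<phi> i \<leadsto> \<psi> i \<leadsto> \<chi> i) (\<lambda>i. (\<phi> i \<leadsto> \<psi> i) \<leadsto> \<phi> i \<leadsto> \<chi> i)"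
  unfolding entails_def by (rule bexI [OF _ sep_s]) (auto simp: Pi_iff intro: comb_s_le)

text \<open>
  Modus ponens is available only when its conclusion is an implication, that is, an entailment. The
  usual derivations from \<open>k\<close> and \<open>s\<close> obey this restriction.
\<close>

lemma entails_s_rule:
  assumes "entails A I \<phi> (\<lambda>i. \<psi> i \<leadsto> \<chi> i)"
    and "\<phi> \<in> I \<rightarrow> carrier A" "\<psi> \<in> I \<rightarrow> carrier A" "\<chi> \<in> I \<rightarrow> carrier A"
  shows "entails A I (\<lambda>i. \<phi> i \<leadsto> \<psi> i) (\<lambda>i. \<phi> i \<leadsto> \<chi> i)"
  by (rule entails_mp [OF entails_s]) (use assms in simp_all)

lemma entails_refl:
  assumes "\<phi> \<in> I \<rightarrow> carrier A"
  shows "entails A I \<phi> \<phi>"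
  by (rule entails_mp [OF entails_s_rule [OF entails_k] entails_k [where \<psi> = \<phi>]])
    (use assms in simp_all)

lemma entails_le:
  assumes "\<And>i. i \<in> I \<Longrightarrow> \<phi> i \<sqsubseteq> \<psi> i" and c: "\<phi> \<in> I \<rightarrow> carrier A" "\<psi> \<in> I \<rightarrow> carrier A"
  shows "entails A I \<phi> \<psi>"
proof -
  obtain r where r: "r \<in> sep A" "\<forall>i \<in> I. r \<sqsubseteq> \<phi> i \<leadsto> \<phi> i"
    using entails_refl [OF c(1)] unfolding entails_def by blast
  have "r \<sqsubseteq> \<phi> i \<leadsto> \<psi> i" if i: "i \<in> I" for i
    by (rule le_trans [of _ "\<phi> i \<leadsto> \<phi> i"])
      (use assms r i in \<open>auto simp: Pi_iff intro!: imp_mono\<close>)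
  with r show ?thesis
    unfolding entails_def by blast
qed

lemma imp_right:
  assumes "entails A I \<psi> \<psi>'"
    and "\<phi> \<in> I \<rightarrow> carrier A" "\<psi> \<in> I \<rightarrow> carrier A" "\<psi>' \<in> I \<rightarrow> carrier A"
  shows "entails A I (\<lambda>i. \<phi> i \<leadsto> \<psi> i) (\<lambda>i. \<phi> i \<leadsto> \<psi>' i)"
proof (rule entails_s_rule)
  show "entails A I \<phi> (\<lambda>i. \<psi> i \<leadsto> \<psi>' i)"
    by (rule entails_mp [OF entails_k assms(1)]) (use assms in simp_all)
qed (use assms in simp_all)

lemma entails_trans:
  assumes "entails A I \<phi> \<psi>" "entails A I \<psi> \<chi>"
    and "\<phi> \<in> I \<rightarrow> carrier A" "\<psi> \<in> I \<rightarrow> carrier A" "\<chi> \<in> I \<rightarrow> carrier A"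
  shows "entails A I \<phi> \<chi>"
  by (rule entails_mp [OF imp_right assms(1)]) (use assms in simp_all)

lemma swap:
  assumes "entails A I \<phi> (\<lambda>i. \<psi> i \<leadsto> \<chi> i)"
    and "\<phi> \<in> I \<rightarrow> carrier A" "\<psi> \<in> I \<rightarrow> carrier A" "\<chi> \<in> I \<rightarrow> carrier A"
  shows "entails A I \<psi> (\<lambda>i. \<phi> i \<leadsto> \<chi> i)"
  by (rule entails_trans [OF entails_k entails_s_rule [OF assms(1)]]) (use assms in simp_all)

lemma imp_left:
  assumes "entails A I \<phi>' \<phi>"
    and c: "\<phi> \<in> I \<rightarrow> carrier A" "\<phi>' \<in> I \<rightarrow> carrier A" "\<psi> \<in> I \<rightarrow> carrier A"
  shows "entails A I (\<lambda>i. \<phi> i \<leadsto> \<psi> i) (\<lambda>i. \<phi>' i \<leadsto> \<psi> i)"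
  \<comment> \<open>Swapping the arguments of \<open>(\<phi> \<leadsto> \<psi>) \<turnstile> (\<phi>' \<leadsto> \<phi>) \<leadsto> \<phi>' \<leadsto> \<psi>\<close> makes the premise available to modus ponens.\<close>
proof (rule entails_mp [OF swap assms(1)])
  show "entails A I (\<lambda>i. \<phi> i \<leadsto> \<psi> i) (\<lambda>i. (\<phi>' i \<leadsto> \<phi> i) \<leadsto> \<phi>' i \<leadsto> \<psi> i)"
    by (rule entails_trans [OF entails_k entails_s]) (use c in simp_all)
qed (use c in simp_all)

lemma imp_eval:
  assumes "\<phi> \<in> I \<rightarrow> carrier A" "\<psi> \<in> I \<rightarrow> carrier A"
  shows "entails A I \<phi> (\<lambda>i. (\<phi> i \<leadsto> \<psi> i) \<leadsto> \<psi> i)"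
  by (rule swap [OF entails_refl]) (use assms in simp_all)

text \<open>An implication with a valid antecedent may be replaced by its consequent.\<close>

lemma discharge:
  assumes "entails A I \<alpha> \<beta>"
    and "\<alpha> \<in> I \<rightarrow> carrier A" "\<beta> \<in> I \<rightarrow> carrier A" "\<psi> \<in> I \<rightarrow> carrier A"
  shows "entails A I (\<lambda>i. (\<alpha> i \<leadsto> \<beta> i) \<leadsto> \<psi> i) \<psi>"
  by (rule entails_mp [OF imp_eval assms(1)]) (use assms in simp_all)

text \<open>
  Introduction of a universal quantifier on the right. As in \<open>entails_mp_sep\<close>, the combinator
  \<open>comb_a A\<close> is what moves the meet across an implication.
\<close>

lemma entails_Inf:
  assumes "entails A (Sigma I J) (\<lambda>(i, j). \<phi> i) (\<lambda>(i, j). \<psi> i j \<leadsto> \<chi> i j)"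
    and c: "\<phi> \<in> I \<rightarrow> carrier A" "\<And>i. i \<in> I \<Longrightarrow> \<psi> i \<in> J i \<rightarrow> carrier A"
      "\<And>i. i \<in> I \<Longrightarrow> \<chi> i \<in> J i \<rightarrow> carrier A"
  shows "entails A I \<phi> (\<lambda>i. \<Sqinter>((\<lambda>j. \<psi> i j \<leadsto> \<chi> i j) ` J i))"
proof -
  let ?W = "\<lambda>i. \<Sqinter>((\<lambda>j. \<psi> i j \<leadsto> \<chi> i j) ` J i)"
    and ?U = "\<lambda>i. \<Sqinter>((\<lambda>j. \<phi> i \<leadsto> \<psi> i j \<leadsto> \<chi> i j) ` J i)"
  obtain r where r: "r \<in> sep A" "\<And>i j. i \<in> I \<Longrightarrow> j \<in> J i \<Longrightarrow> r \<sqsubseteq> \<phi> i \<leadsto> \<psi> i j \<leadsto> \<chi> i j"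
    using assms(1) unfolding entails_def by auto
  have sub: "(\<lambda>j. \<psi> i j \<leadsto> \<chi> i j) ` J i \<subseteq> carrier A"
    "(\<lambda>j. \<phi> i \<leadsto> \<psi> i j \<leadsto> \<chi> i j) ` J i \<subseteq> carrier A" if "i \<in> I" for i
    using c that by (auto simp: Pi_iff)
  have W: "?W \<in> I \<rightarrow> carrier A" and U: "?U \<in> I \<rightarrow> carrier A"
    using sub by auto
  have rU: "r \<sqsubseteq> ?U i" if "i \<in> I" for i
    using r that c by (intro inf_greatest sub) (auto simp: Pi_iff)
  have "comb_a A \<sqsubseteq> r \<leadsto> \<phi> i \<leadsto> ?W i" if i: "i \<in> I" for i
  proof (rule le_trans)
    show "comb_a A \<sqsubseteq> ?U i \<leadsto> \<phi> i \<leadsto> ?W i"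
      using c i by (intro comb_a_le) auto
    show "?U i \<leadsto> \<phi> i \<leadsto> ?W i \<sqsubseteq> r \<leadsto> \<phi> i \<leadsto> ?W i"
      using rU [OF i] r(1) c(1) U W i by (intro imp_mono) (auto simp: Pi_iff)
  qed (use i r(1) sep_a c(1) U W in \<open>auto simp: Pi_iff\<close>)
  then have "entails A I (\<lambda>_. r) (\<lambda>i. \<phi> i \<leadsto> ?W i)"
    using sep_a unfolding entails_def by blast
  with r(1) c(1) W show ?thesis
    by (rule_tac entails_mp_sep)
qed

lemma delta_closed [simp]: "a \<in> carrier A \<Longrightarrow> delta A a \<in> carrier A"
  by (simp add: delta_def)

lemma delta_entails:
  assumes "\<phi> \<in> I \<rightarrow> carrier A"
  shows "entails A I (\<lambda>i. delta A (\<phi> i)) \<phi>"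
  by (rule entails_mp_sep [OF top_sep]) (use assms imp_eval [of "\<lambda>_. \<top>" I \<phi>] in \<open>auto simp: delta_def\<close>)

end

section \<open>The preorder-enriched category of arrow algebras\<close>

lemma mor_le_entails:
  assumes "arrow_algebra B" "f \<in> carrier A \<rightarrow> carrier B" "g \<in> carrier A \<rightarrow> carrier B"
  shows "mor_le A B f g \<longleftrightarrow> entails B (carrier A) f g"
  unfolding mor_le_def Setcompr_eq_image
  using arrow_algebra.entails_iff_Inf [OF assms] by simp

text \<open>
  In terms of uniform entailment, an implicative morphism is a map that preserves the separator and
  the entailment of families over any index set, and satisfies \<open>f (a \<leadsto> a') \<turnstile> f a \<leadsto> f a'\<close>: a
  transformation of the associated triposes. In this form composition and transport along an
  isomorphism come down to transitivity.
\<close>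

lemma implicative_morphismI:
  assumes "arrow_algebra A" "arrow_algebra B" "f \<in> carrier A \<rightarrow>\<^sub>E carrier B"
    and "\<And>a. a \<in> sep A \<Longrightarrow> f a \<in> sep B"
    and imp: "entails B (carrier A \<times> carrier A) (\<lambda>(a, a'). f (a \<leadsto>\<^bsub>A\<^esub> a')) (\<lambda>(a, a'). f a \<leadsto>\<^bsub>B\<^esub> f a')"
    and unif: "\<And>X. X \<subseteq> carrier A \<times> carrier A \<Longrightarrow> entails A X fst snd
      \<Longrightarrow> entails B X (\<lambda>x. f (fst x)) (\<lambda>x. f (snd x))"
  shows "implicative_morphism A B f"
proof -
  interpret A: arrow_algebra A by fact
  interpret B: arrow_algebra B by fact
  show ?thesis
  proof
    show "\<exists>r \<in> sep B. \<forall>a \<in> carrier A. \<forall>a' \<in> carrier A.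
        r \<sqsubseteq>\<^bsub>B\<^esub> f (a \<leadsto>\<^bsub>A\<^esub> a') \<leadsto>\<^bsub>B\<^esub> f a \<leadsto>\<^bsub>B\<^esub> f a'"
      using imp unfolding entails_def by simp
  next
    fix X
    assume X: "X \<subseteq> carrier A \<times> carrier A"
      and s: "\<Sqinter>\<^bsub>A\<^esub>{a \<leadsto>\<^bsub>A\<^esub> a' | a a'. (a, a') \<in> X} \<in> sep A"
    have img: "{a \<leadsto>\<^bsub>A\<^esub> a' | a a'. (a, a') \<in> X} = (\<lambda>x. fst x \<leadsto>\<^bsub>A\<^esub> snd x) ` X"
      "{f a \<leadsto>\<^bsub>B\<^esub> f a' | a a'. (a, a') \<in> X} = (\<lambda>x. f (fst x) \<leadsto>\<^bsub>B\<^esub> f (snd x)) ` X"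
      by (rule Setcompr_pairs)+
    have "fst \<in> X \<rightarrow> carrier A" "snd \<in> X \<rightarrow> carrier A"
      "(\<lambda>x. f (fst x)) \<in> X \<rightarrow> carrier B" "(\<lambda>x. f (snd x)) \<in> X \<rightarrow> carrier B"
      using X assms(3) by (auto simp: Pi_iff PiE_iff)
    then show "\<Sqinter>\<^bsub>B\<^esub>{f a \<leadsto>\<^bsub>B\<^esub> f a' | a a'. (a, a') \<in> X} \<in> sep B"
      using unif [OF X] s by (simp add: img A.entails_iff_Inf B.entails_iff_Inf)
  qed (simp_all add: assms)
qed

context implicative_morphism
begin

lemma map_Pi: "f \<in> carrier A \<rightarrow> carrier B"
  using map_carrier by auto

lemma map_closed [simp]: "a \<in> carrier A \<Longrightarrow> f a \<in> carrier B"
  using map_Pi by auto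

lemma map_family [simp]: "\<phi> \<in> I \<rightarrow> carrier A \<Longrightarrow> (\<lambda>i. f (\<phi> i)) \<in> I \<rightarrow> carrier B"
  by (auto simp: Pi_iff)

text \<open>
  The set \<open>X\<close> of pairs in the definition of implicative morphisms plays the role of a family: take
  \<open>X = {(\<phi> i, \<psi> i) | i \<in> I}\<close>.
\<close>

lemma map_entails:
  assumes "entails A I \<phi> \<psi>" and c: "\<phi> \<in> I \<rightarrow> carrier A" "\<psi> \<in> I \<rightarrow> carrier A"
  shows "entails B I (\<lambda>i. f (\<phi> i)) (\<lambda>i. f (\<psi> i))"
proof -
  let ?X = "(\<lambda>i. (\<phi> i, \<psi> i)) ` I"
  have img: "{a \<leadsto>\<^bsub>A\<^esub> a' | a a'. (a, a') \<in> ?X} = (\<lambda>i. \<phi> i \<leadsto>\<^bsub>A\<^esub> \<psi> i) ` I"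
    "{f a \<leadsto>\<^bsub>B\<^esub> f a' | a a'. (a, a') \<in> ?X} = (\<lambda>i. f (\<phi> i) \<leadsto>\<^bsub>B\<^esub> f (\<psi> i)) ` I"
    by auto
  have X: "?X \<subseteq> carrier A \<times> carrier A"
    using c by auto
  show ?thesis
    using map_uniform [OF X] assms unfolding img
    by (simp add: A.entails_iff_Inf B.entails_iff_Inf)
qed

lemma map_imp_entails:
  assumes "\<phi> \<in> I \<rightarrow> carrier A" "\<psi> \<in> I \<rightarrow> carrier A"
  shows "entails B I (\<lambda>i. f (\<phi> i \<leadsto>\<^bsub>A\<^esub> \<psi> i)) (\<lambda>i. f (\<phi> i) \<leadsto>\<^bsub>B\<^esub> f (\<psi> i))"
  using map_imp assms unfolding entails_def by (meson PiE)

lemma map_sep_entails: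
  assumes "t \<in> sep B" and c: "a \<in> sep A" 
  shows "entails B I (\<lambda>i. t) (\<lambda>i. f a)"
  using B.entails_mp_sep [OF map_sep [OF c], of I "\<lambda>_. t" "\<lambda>_. f a"]
    B.entails_k [of "\<lambda>_. f a" I "\<lambda>_. t"] assms by simp

end

text \<open>Used below to replace a morphism by its monotone hull.\<close>

lemma implicative_morphism_iso:
  assumes f: "implicative_morphism A B f" and g: "g \<in> carrier A \<rightarrow>\<^sub>E carrier B"
    and fg: "entails B (carrier A) f g" and gf: "entails B (carrier A) g f"
  shows "implicative_morphism A B g"
proof -
  interpret f: implicative_morphism A B f by fact
  have gc [simp]: "g a \<in> carrier B" if "a \<in> carrier A" for a
    using g that by auto
  have fg': "entails B I (\<lambda>i. f (\<phi> i)) (\<lambda>i. g (\<phi> i))"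
    and gf': "entails B I (\<lambda>i. g (\<phi> i)) (\<lambda>i. f (\<phi> i))"
    if "\<phi> \<in> I \<rightarrow> carrier A" for I and \<phi> :: "'i \<Rightarrow> 'a"
    using entails_reindex [OF fg that] entails_reindex [OF gf that] .
  have gPi: "(\<lambda>i. g (\<phi> i)) \<in> I \<rightarrow> carrier B" if "\<phi> \<in> I \<rightarrow> carrier A" for I and \<phi> :: "'i \<Rightarrow> 'a"
    using that by (auto simp: Pi_iff)
  show ?thesis
  proof (rule implicative_morphismI)
    fix a assume a: "a \<in> sep A"
    then have "a \<in> carrier A"
      by simp
    then obtain r where "r \<in> sep B" "r \<sqsubseteq>\<^bsub>B\<^esub> f a \<leadsto>\<^bsub>B\<^esub> g a"
      using fg unfolding entails_def by metis
    then have "f a \<leadsto>\<^bsub>B\<^esub> g a \<in> sep B"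
      using a f.B.sep_upward [of r "f a \<leadsto>\<^bsub>B\<^esub> g a"] by simp
    then show "g a \<in> sep B"
      using f.B.sep_mp [of "f a" "g a"] f.map_sep [OF a] a by simp
  next
    let ?I = "carrier A \<times> carrier A"
    have p: "fst \<in> ?I \<rightarrow> carrier A" "snd \<in> ?I \<rightarrow> carrier A"
      by auto
    have 1: "entails B ?I (\<lambda>x. g (fst x \<leadsto>\<^bsub>A\<^esub> snd x)) (\<lambda>x. f (fst x \<leadsto>\<^bsub>A\<^esub> snd x))"
      by (rule gf') (use p in simp)
    have 2: "entails B ?I (\<lambda>x. f (fst x \<leadsto>\<^bsub>A\<^esub> snd x)) (\<lambda>x. f (fst x) \<leadsto>\<^bsub>B\<^esub> f (snd x))"
      by (rule f.map_imp_entails) (fact p)+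
    have 3: "entails B ?I (\<lambda>x. f (fst x) \<leadsto>\<^bsub>B\<^esub> f (snd x)) (\<lambda>x. g (fst x) \<leadsto>\<^bsub>B\<^esub> f (snd x))"
      by (rule f.B.imp_left [OF gf' [OF p(1)]]) (use p in \<open>simp_all add: gPi\<close>)
    have 4: "entails B ?I (\<lambda>x. g (fst x) \<leadsto>\<^bsub>B\<^esub> f (snd x)) (\<lambda>x. g (fst x) \<leadsto>\<^bsub>B\<^esub> g (snd x))"
      by (rule f.B.imp_right [OF fg' [OF p(2)]]) (use p in \<open>simp_all add: gPi\<close>)
    show "entails B ?I (\<lambda>(a, a'). g (a \<leadsto>\<^bsub>A\<^esub> a')) (\<lambda>(a, a'). g a \<leadsto>\<^bsub>B\<^esub> g a')"
      unfolding case_prod_beta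
      by (rule f.B.entails_trans [OF f.B.entails_trans [OF f.B.entails_trans [OF 1 2] 3] 4])
        (use p in \<open>simp_all add: gPi\<close>)
  next
    fix X :: "('a \<times> 'a) set" assume X: "X \<subseteq> carrier A \<times> carrier A" and u: "entails A X fst snd"
    have p: "fst \<in> X \<rightarrow> carrier A" "snd \<in> X \<rightarrow> carrier A"
      using X by auto
    show "entails B X (\<lambda>x. g (fst x)) (\<lambda>x. g (snd x))"
      using f.B.entails_trans [OF f.B.entails_trans [OF gf' [OF p(1)] f.map_entails [OF u p]] fg' [OF p(2)]]
        p by (simp add: gPi)
  qed (simp_all add: f.A.arrow_algebra_axioms f.B.arrow_algebra_axioms g)
qed

lemma id_mor_implicative:
  assumes "arrow_algebra A"
  shows "implicative_morphism A A (id_mor A)"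
proof -
  interpret arrow_algebra A by fact
  show ?thesis
  proof (rule implicative_morphismI)
    have "entails A (carrier A \<times> carrier A) (\<lambda>x. fst x \<leadsto>\<^bsub>A\<^esub> snd x) (\<lambda>x. fst x \<leadsto>\<^bsub>A\<^esub> snd x)"
      by (rule entails_refl) auto
    then show "entails A (carrier A \<times> carrier A) (\<lambda>(a, a'). id_mor A (a \<leadsto>\<^bsub>A\<^esub> a'))
        (\<lambda>(a, a'). id_mor A a \<leadsto>\<^bsub>A\<^esub> id_mor A a')"
      by (rule entails_cong) (auto simp: id_mor_def)
  next
    fix X :: "('a \<times> 'a) set" assume X: "X \<subseteq> carrier A \<times> carrier A" and u: "entails A X fst snd"
    show "entails A X (\<lambda>x. id_mor A (fst x)) (\<lambda>x. id_mor A (snd x))"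
      by (rule entails_cong [OF u]) (use X in \<open>auto simp: id_mor_def\<close>)
  qed (use assms in \<open>auto simp: id_mor_def\<close>)
qed

lemma compose_implicative:
  assumes f: "implicative_morphism A B f" and g: "implicative_morphism B C g"
  shows "implicative_morphism A C (compose (carrier A) g f)"
proof -
  interpret f: implicative_morphism A B f by fact
  interpret g: implicative_morphism B C g by fact
  show ?thesis
  proof (rule implicative_morphismI)
    let ?I = "carrier A \<times> carrier A"
    have p: "fst \<in> ?I \<rightarrow> carrier A" "snd \<in> ?I \<rightarrow> carrier A"
      by auto
    have "entails C ?I (\<lambda>x. g (f (fst x \<leadsto>\<^bsub>A\<^esub> snd x))) (\<lambda>x. g (f (fst x) \<leadsto>\<^bsub>B\<^esub> f (snd x)))"
      by (rule g.map_entails [OF f.map_imp_entails]) (use p in simp_all)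
    moreover have "entails C ?I (\<lambda>x. g (f (fst x) \<leadsto>\<^bsub>B\<^esub> f (snd x)))
        (\<lambda>x. g (f (fst x)) \<leadsto>\<^bsub>C\<^esub> g (f (snd x)))"
      by (rule g.map_imp_entails) (use p in simp_all)
    ultimately have "entails C ?I (\<lambda>x. g (f (fst x \<leadsto>\<^bsub>A\<^esub> snd x)))
        (\<lambda>x. g (f (fst x)) \<leadsto>\<^bsub>C\<^esub> g (f (snd x)))"
      by (rule g.B.entails_trans) (use p in simp_all)
    then show "entails C ?I (\<lambda>(a, a'). compose (carrier A) g f (a \<leadsto>\<^bsub>A\<^esub> a'))
        (\<lambda>(a, a'). compose (carrier A) g f a \<leadsto>\<^bsub>C\<^esub> compose (carrier A) g f a')"
      by (rule entails_cong) (auto simp: compose_eq)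
  next
    fix X :: "('a \<times> 'a) set" assume X: "X \<subseteq> carrier A \<times> carrier A" and u: "entails A X fst snd"
    have p: "fst \<in> X \<rightarrow> carrier A" "snd \<in> X \<rightarrow> carrier A"
      using X by auto
    have "entails C X (\<lambda>x. g (f (fst x))) (\<lambda>x. g (f (snd x)))"
      by (rule g.map_entails [OF f.map_entails [OF u]]) (use p in simp_all)
    then show "entails C X (\<lambda>x. compose (carrier A) g f (fst x)) (\<lambda>x. compose (carrier A) g f (snd x))"
      by (rule entails_cong) (use X in \<open>auto simp: compose_eq\<close>)
  qed (simp_all add: f.A.arrow_algebra_axioms g.B.arrow_algebra_axioms compose_eq f.map_sep g.map_sep
    compose_def)
qed

lemma mor_le_refl:
  assumes "implicative_morphism A B f"
  shows "mor_le A B f f"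
proof -
  interpret implicative_morphism A B f by fact
  show ?thesis
    by (simp add: mor_le_entails B.arrow_algebra_axioms map_Pi B.entails_refl)
qed

lemma mor_le_trans:
  assumes "implicative_morphism A B f" "implicative_morphism A B g" "implicative_morphism A B h"
    and "mor_le A B f g" "mor_le A B g h"
  shows "mor_le A B f h"
proof -
  interpret f: implicative_morphism A B f by fact
  interpret g: implicative_morphism A B g by fact
  interpret h: implicative_morphism A B h by fact
  show ?thesis
    using assms(4,5) f.B.entails_trans [of "carrier A" f g h]
    by (simp add: mor_le_entails f.B.arrow_algebra_axioms f.map_Pi g.map_Pi h.map_Pi)
qed

lemma mor_le_compose:
  assumes f: "implicative_morphism A B f" "implicative_morphism A B f'"
    and g: "implicative_morphism B C g" "implicative_morphism B C g'"
    and le: "mor_le A B f f'" "mor_le B C g g'"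
  shows "mor_le A C (compose (carrier A) g f) (compose (carrier A) g' f')"
proof -
  interpret f: implicative_morphism A B f by fact
  interpret f': implicative_morphism A B f' by fact
  interpret g: implicative_morphism B C g by fact
  interpret g': implicative_morphism B C g' by fact
  have ff: "entails B (carrier A) f f'" and gg: "entails C (carrier B) g g'"
    using le by (simp_all add: mor_le_entails f.B.arrow_algebra_axioms g.B.arrow_algebra_axioms
      f.map_Pi f'.map_Pi g.map_Pi g'.map_Pi)
  have "entails C (carrier A) (\<lambda>a. g (f a)) (\<lambda>a. g (f' a))"
    by (rule g.map_entails [OF ff f.map_Pi f'.map_Pi])
  moreover have "entails C (carrier A) (\<lambda>a. g (f' a)) (\<lambda>a. g' (f' a))"
    by (rule entails_reindex [OF gg f'.map_Pi])
  ultimately have "entails C (carrier A) (\<lambda>a. g (f a)) (\<lambda>a. g' (f' a))"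
    by (rule g.B.entails_trans) auto
  then have "entails C (carrier A) (compose (carrier A) g f) (compose (carrier A) g' f')"
    by (rule entails_cong) (auto simp: compose_eq)
  then show ?thesis
    by (subst mor_le_entails) (auto simp: g.B.arrow_algebra_axioms compose_eq)
qed

lemma preorder_category_ArrAlg: "preorder_category ArrAlg"
proof
  fix A :: "'u arrow_alg" assume "A \<in> Obj ArrAlg"
  then show "Idt ArrAlg A \<in> Hom ArrAlg A A"
    by (simp add: ArrAlg_def id_mor_implicative)
next
  fix A B C D :: "'u arrow_alg" and f g h
  assume "f \<in> Hom ArrAlg A B" "g \<in> Hom ArrAlg B C" "h \<in> Hom ArrAlg C D"
  then show "Comp ArrAlg A C D h (Comp ArrAlg A B C g f)
      = Comp ArrAlg A B D (Comp ArrAlg B C D h g) f"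
    by (simp add: ArrAlg_def compose_assoc implicative_morphism.map_Pi)
next
  fix A B :: "'u arrow_alg" and f assume "f \<in> Hom ArrAlg A B"
  then have f: "f \<in> carrier A \<rightarrow>\<^sub>E carrier B"
    by (simp add: ArrAlg_def implicative_morphism.map_carrier)
  show "Comp ArrAlg A B B (Idt ArrAlg B) f = f"
    using f by (auto simp: ArrAlg_def id_mor_def PiE_def intro: Id_compose)
  show "Comp ArrAlg A A B f (Idt ArrAlg A) = f"
    using f by (auto simp: ArrAlg_def id_mor_def PiE_def intro: compose_Id)
qed (auto simp: ArrAlg_def intro: compose_implicative mor_le_refl mor_le_trans mor_le_compose)

lemma preorder_category_full_subcategory:
  assumes "preorder_category C"
  shows "preorder_category (full_subcategory C P)"
proof -
  interpret preorder_category C by fact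
  show ?thesis
    by unfold_locales
      (auto simp: full_subcategory_def id_left id_right
        intro: id_hom comp_hom comp_assoc hom_le_refl hom_le_trans comp_mono)
qed

section \<open>The arrow algebra of a nucleus\<close>

locale nucleus = arrow_algebra +
  fixes j :: "'a \<Rightarrow> 'a"
  assumes j_closed [simp]: "a \<in> carrier A \<Longrightarrow> j a \<in> carrier A"
    and j_mono: "\<lbrakk>a \<in> carrier A; b \<in> carrier A; a \<sqsubseteq> b\<rbrakk> \<Longrightarrow> j a \<sqsubseteq> j b"
    and j_unit: "entails A (carrier A) (\<lambda>a. a) j"
    and j_bind: "entails A (carrier A \<times> carrier A) (\<lambda>(a, b). a \<leadsto> j b) (\<lambda>(a, b). j a \<leadsto> j b)"
begin

abbreviation Aj :: "'a arrow_alg" where "Aj \<equiv> nucleus_alg A j"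

lemma j_family [simp]: "\<phi> \<in> I \<rightarrow> carrier A \<Longrightarrow> (\<lambda>i. j (\<phi> i)) \<in> I \<rightarrow> carrier A"
  by (simp add: Pi_iff)

lemma entails_unit: "\<phi> \<in> I \<rightarrow> carrier A \<Longrightarrow> entails A I \<phi> (\<lambda>i. j (\<phi> i))"
  using entails_reindex [OF j_unit] .

lemma entails_bind:
  assumes "\<phi> \<in> I \<rightarrow> carrier A" "\<psi> \<in> I \<rightarrow> carrier A"
  shows "entails A I (\<lambda>i. \<phi> i \<leadsto> j (\<psi> i)) (\<lambda>i. j (\<phi> i) \<leadsto> j (\<psi> i))"
  using entails_reindex [OF j_bind, of "\<lambda>i. (\<phi> i, \<psi> i)" I] assms by (simp add: Pi_iff)

lemma bind:
  assumes "entails A I \<phi> (\<lambda>i. j (\<psi> i))" and c: "\<phi> \<in> I \<rightarrow> carrier A" "\<psi> \<in> I \<rightarrow> carrier A"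
  shows "entails A I (\<lambda>i. j (\<phi> i)) (\<lambda>i. j (\<psi> i))"
  by (rule entails_mp [OF entails_bind assms(1)]) (use c in simp_all)

text \<open>
  An implication into \<open>j b\<close> absorbs an outer \<open>j\<close>, since \<open>a\<close> entails \<open>(a \<leadsto> j b) \<leadsto> j b\<close> and the nucleus
  extends the latter to \<open>j (a \<leadsto> j b) \<leadsto> j b\<close>. This removes the iterated occurrences of \<open>j\<close> in the
  combinators of \<open>A\<^sub>j\<close>.
\<close>

lemma j_imp_absorb:
  assumes c: "\<phi> \<in> I \<rightarrow> carrier A" "\<psi> \<in> I \<rightarrow> carrier A"
  shows "entails A I (\<lambda>i. j (\<phi> i \<leadsto> j (\<psi> i))) (\<lambda>i. \<phi> i \<leadsto> j (\<psi> i))"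
proof (rule swap)
  show "entails A I \<phi> (\<lambda>i. j (\<phi> i \<leadsto> j (\<psi> i)) \<leadsto> j (\<psi> i))"
    by (rule entails_trans [OF imp_eval entails_bind]) (use c in simp_all)
qed (use c in simp_all)

lemma j_imp:
  assumes c: "\<phi> \<in> I \<rightarrow> carrier A" "\<psi> \<in> I \<rightarrow> carrier A"
  shows "entails A I (\<lambda>i. j (\<phi> i \<leadsto> j (\<psi> i))) (\<lambda>i. j (\<phi> i) \<leadsto> j (\<psi> i))"
  by (rule entails_trans [OF j_imp_absorb entails_bind]) (use c in simp_all)

lemma sep_j: "a \<in> sep A \<Longrightarrow> j a \<in> sep A"
proof -
  assume a: "a \<in> sep A"
  obtain r where "r \<in> sep A" "\<forall>a \<in> carrier A. r \<sqsubseteq> a \<leadsto> j a"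
    using j_unit unfolding entails_def by blast
  then have "a \<leadsto> j a \<in> sep A"
    using a sep_upward [of r "a \<leadsto> j a"] by simp
  then show ?thesis
    using a sep_mp [of a "j a"] by simp
qed

lemma nucleus_alg_simps:
  "carrier Aj = carrier A" "le Aj = le A" "eq Aj = eq A"
  "imp Aj = (\<lambda>a b. a \<leadsto> j b)" "sep Aj = {a \<in> carrier A. j a \<in> sep A}"
  by (simp_all add: nucleus_alg_def)

lemma Lower_nucleus_alg: "Lower Aj = Lower A"
  by (simp add: fun_eq_iff Lower_def nucleus_alg_simps)

lemma greatest_nucleus_alg: "greatest Aj = greatest A"
  by (simp add: fun_eq_iff greatest_def nucleus_alg_simps)

lemma Inf_nucleus_alg: "Lattice.inf Aj X = \<Sqinter>X"
  by (simp add: inf_def Lower_nucleus_alg greatest_nucleus_alg)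

lemma sep_subset_nucleus_alg: "sep A \<subseteq> sep Aj"
  using sep_j by (auto simp: nucleus_alg_simps)

text \<open>
  A realizer of an entailment in \<open>A\<^sub>j\<close> is an element \<open>r\<close> with \<open>j r\<close> in the separator of \<open>A\<close>. Since
  \<open>j r \<sqsubseteq> j (a \<leadsto> j b)\<close> and \<open>j (a \<leadsto> j b) \<turnstile> a \<leadsto> j b\<close>, it can be turned into one that lies in the
  separator of \<open>A\<close> itself.
\<close>

lemma entails_nucleus_alg:
  assumes c: "\<phi> \<in> I \<rightarrow> carrier A" "\<psi> \<in> I \<rightarrow> carrier A"
  shows "entails Aj I \<phi> \<psi> \<longleftrightarrow> entails A I \<phi> (\<lambda>i. j (\<psi> i))"
proof
  assume "entails A I \<phi> (\<lambda>i. j (\<psi> i))"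
  then show "entails Aj I \<phi> \<psi>"
    using sep_subset_nucleus_alg unfolding entails_def nucleus_alg_simps by blast
next
  assume "entails Aj I \<phi> \<psi>"
  then obtain r where r: "r \<in> carrier A" "j r \<in> sep A" "\<forall>i \<in> I. r \<sqsubseteq> \<phi> i \<leadsto> j (\<psi> i)"
    unfolding entails_def nucleus_alg_simps by blast
  have "entails A I (\<lambda>_. j r) (\<lambda>i. j (\<phi> i \<leadsto> j (\<psi> i)))"
    using r c by (intro entails_le j_mono) (auto simp: Pi_iff)
  then have "entails A I (\<lambda>_. j r) (\<lambda>i. \<phi> i \<leadsto> j (\<psi> i))"
    by (rule entails_trans [OF _ j_imp_absorb]) (use r c in simp_all)
  then show "entails A I \<phi> (\<lambda>i. j (\<psi> i))"
    by (rule entails_mp_sep [OF r(2)]) (use c in simp_all)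
qed

lemma entails_imp_entails_nucleus_alg:
  assumes "entails A I \<phi> \<psi>" and c: "\<phi> \<in> I \<rightarrow> carrier A" "\<psi> \<in> I \<rightarrow> carrier A"
  shows "entails Aj I \<phi> \<psi>"
  unfolding entails_nucleus_alg [OF c]
  by (rule entails_trans [OF assms(1) entails_unit]) (use c in simp_all)

lemma sep_nucleus_algI:
  assumes "entails A I \<phi> \<psi>" "X \<subseteq> carrier A"
    and "\<And>x. x \<in> X \<Longrightarrow> \<exists>i \<in> I. x = \<phi> i \<leadsto> \<psi> i"
  shows "\<Sqinter>X \<in> sep Aj"
proof -
  obtain r where r: "r \<in> sep A" "\<forall>i \<in> I. r \<sqsubseteq> \<phi> i \<leadsto> \<psi> i"
    using assms(1) unfolding entails_def by blast
  have "\<Sqinter>X \<in> sep A"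
    by (rule Inf_sep [OF r(1) assms(2)]) (metis r(2) assms(3))
  then show ?thesis
    using sep_subset_nucleus_alg by blast
qed

lemma comb_k_nucleus_alg: "comb_k Aj \<in> sep Aj"
proof -
  let ?I = "carrier A \<times> carrier A"
  have p: "fst \<in> ?I \<rightarrow> carrier A" "snd \<in> ?I \<rightarrow> carrier A"
    by auto
  have 1: "entails A ?I fst (\<lambda>i. j (snd i \<leadsto> j (fst i)))"
    by (rule entails_trans [OF entails_trans [OF entails_unit entails_k] entails_unit])
      (use p in simp_all)
  show ?thesis
    unfolding comb_k_def Inf_nucleus_alg nucleus_alg_simps(1,4)
    by (rule sep_nucleus_algI [OF 1]) (auto simp: Bex_def)
qed

lemma comb_s_nucleus_alg: "comb_s Aj \<in> sep Aj"
proof -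
  let ?I = "carrier A \<times> carrier A \<times> carrier A"
    and ?b = "\<lambda>i. fst (snd i)" and ?c = "\<lambda>i. snd (snd i)"
  have p: "fst \<in> ?I \<rightarrow> carrier A" "?b \<in> ?I \<rightarrow> carrier A" "?c \<in> ?I \<rightarrow> carrier A"
    by auto
  have 1: "entails A ?I (\<lambda>i. fst i \<leadsto> j (?b i \<leadsto> j (?c i))) (\<lambda>i. fst i \<leadsto> j (?b i) \<leadsto> j (?c i))"
    by (rule imp_right [OF j_imp]) (use p in simp_all)
  have 2: "entails A ?I (\<lambda>i. fst i \<leadsto> j (?b i) \<leadsto> j (?c i))
      (\<lambda>i. (fst i \<leadsto> j (?b i)) \<leadsto> fst i \<leadsto> j (?c i))"
    by (rule entails_s) (use p in simp_all)
  have 3: "entails A ?I (\<lambda>i. (fst i \<leadsto> j (?b i)) \<leadsto> fst i \<leadsto> j (?c i))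
      (\<lambda>i. (fst i \<leadsto> j (?b i)) \<leadsto> j (fst i \<leadsto> j (?c i)))"
    by (rule imp_right [OF entails_unit]) (use p in simp_all)
  have 4: "entails A ?I (\<lambda>i. fst i \<leadsto> j (?b i \<leadsto> j (?c i)))
      (\<lambda>i. j ((fst i \<leadsto> j (?b i)) \<leadsto> j (fst i \<leadsto> j (?c i))))"
    by (rule entails_trans [OF entails_trans [OF entails_trans [OF 1 2] 3] entails_unit])
      (use p in simp_all)
  show ?thesis
    unfolding comb_s_def Inf_nucleus_alg nucleus_alg_simps(1,4)
    by (rule sep_nucleus_algI [OF 4]) (auto simp: Bex_def)
qed

text \<open>
  The family \<open>a \<leadsto> j (b \<leadsto> j c)\<close> over \<open>(b, c) \<in> X\<close> entails \<open>a \<leadsto> b \<leadsto> j c\<close> uniformly, and to the meet of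
  the latter the combinator \<open>comb_a A\<close> applies. The index of the entailment is the pair \<open>(a, X)\<close>.
\<close>

lemma comb_a_nucleus_alg: "comb_a Aj \<in> sep Aj"
proof -
  let ?I = "carrier A \<times> Pow (carrier A \<times> carrier A)"
  let ?U = "\<lambda>(a, X). \<Sqinter>{a \<leadsto> j (b \<leadsto> j c) | b c. (b, c) \<in> X}"
    and ?W = "\<lambda>(a, X). \<Sqinter>{b \<leadsto> j c | b c. (b, c) \<in> X}"
  have UW: "?U \<in> ?I \<rightarrow> carrier A" "?W \<in> ?I \<rightarrow> carrier A"
    by (auto intro!: inf_closed)
  have fst: "fst \<in> ?I \<rightarrow> carrier A"
    by auto
  let ?S = "SIGMA i:?I. snd i"
  have 1: "entails A ?S (\<lambda>(i, x). ?U i) (\<lambda>(i, x). fst i \<leadsto> j (fst x \<leadsto> j (snd x)))"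
  proof (rule entails_le)
    fix k assume "k \<in> ?S"
    then show "(\<lambda>(i, x). ?U i) k \<sqsubseteq> (\<lambda>(i, x). fst i \<leadsto> j (fst x \<leadsto> j (snd x))) k"
      unfolding Setcompr_pairs by (auto intro!: inf_lower intro: rev_image_eqI)
  qed (auto intro!: inf_closed)
  have 2: "entails A ?S (\<lambda>(i, x). fst i \<leadsto> j (fst x \<leadsto> j (snd x)))
      (\<lambda>(i, x). fst i \<leadsto> fst x \<leadsto> j (snd x))"
    unfolding case_prod_beta by (rule imp_right [OF j_imp_absorb]) auto
  have "entails A ?S (\<lambda>(i, x). ?U i) (\<lambda>(i, x). fst i \<leadsto> fst x \<leadsto> j (snd x))"
    by (rule entails_trans [OF 1 2]) (auto intro!: inf_closed)
  then have 3: "entails A ?I ?U (\<lambda>i. \<Sqinter>((\<lambda>x. fst i \<leadsto> fst x \<leadsto> j (snd x)) ` snd i))"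
    by (rule entails_Inf) (use UW in auto)
  have 4: "entails A ?I (\<lambda>i. \<Sqinter>((\<lambda>x. fst i \<leadsto> fst x \<leadsto> j (snd x)) ` snd i)) (\<lambda>i. fst i \<leadsto> ?W i)"
    unfolding entails_def
  proof (intro bexI [OF _ sep_a] ballI)
    fix i assume i: "i \<in> ?I"
    have img: "?W i = \<Sqinter>((\<lambda>x. fst x \<leadsto> j (snd x)) ` snd i)"
      by (cases i) (simp add: Setcompr_pairs)
    show "comb_a A \<sqsubseteq> \<Sqinter>((\<lambda>x. fst i \<leadsto> fst x \<leadsto> j (snd x)) ` snd i) \<leadsto> fst i \<leadsto> ?W i"
      unfolding img by (rule comb_a_le) (use i in auto)
  qed
  have "entails A ?I ?U (\<lambda>i. fst i \<leadsto> ?W i)"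
    by (rule entails_trans [OF 3 4]) (use UW fst in \<open>auto intro!: inf_closed\<close>)
  then have 5: "entails A ?I ?U (\<lambda>i. j (fst i \<leadsto> j (?W i)))"
    by (rule entails_trans [OF entails_trans [OF _ imp_right [OF entails_unit]] entails_unit])
      (use UW fst in simp_all)
  show ?thesis
    unfolding comb_a_def Inf_nucleus_alg nucleus_alg_simps(1,4)
  proof (rule sep_nucleus_algI [OF 5])
    show "{\<Sqinter>{a \<leadsto> j (b \<leadsto> j c) | b c. (b, c) \<in> X} \<leadsto> j (a \<leadsto> j (\<Sqinter>{b \<leadsto> j c | b c. (b, c) \<in> X}))
        | a X. a \<in> carrier A \<and> X \<subseteq> carrier A \<times> carrier A} \<subseteq> carrier A"
      using UW by (auto simp: Pi_iff)
  qed auto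
qed

lemma arrow_algebra_nucleus_alg: "arrow_algebra Aj"
proof -
  have "partial_order Aj"
    by unfold_locales (auto simp: nucleus_alg_simps eq_is_equal intro: le_antisym le_trans)
  then interpret Aj: partial_order Aj .
  show ?thesis
  proof
    fix a b assume ab: "a \<in> carrier Aj" "b \<in> carrier Aj" "imp Aj a b \<in> sep Aj" "a \<in> sep Aj"
    then have c: "a \<in> carrier A" "b \<in> carrier A" and s: "j (a \<leadsto> j b) \<in> sep A" "j a \<in> sep A"
      unfolding nucleus_alg_simps by auto
    obtain r where r: "r \<in> sep A" "r \<sqsubseteq> j (a \<leadsto> j b) \<leadsto> j a \<leadsto> j b"
      using j_imp [of "\<lambda>_. a" "{()}" "\<lambda>_. b"] c unfolding entails_def by auto
    have "j (a \<leadsto> j b) \<leadsto> j a \<leadsto> j b \<in> sep A"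
      by (rule sep_upward [OF r(1) _ r(2)]) (use c in simp)
    then have "j a \<leadsto> j b \<in> sep A"
      by (rule sep_mp [rotated 2]) (use c s in simp_all)
    then have "j b \<in> sep A"
      by (rule sep_mp [rotated 2]) (use c s in simp_all)
    then show "b \<in> sep Aj"
      using c unfolding nucleus_alg_simps by blast
  next
    fix a b assume "a \<in> sep Aj" "b \<in> carrier Aj" "le Aj a b"
    then show "b \<in> sep Aj"
      unfolding nucleus_alg_simps by (auto intro: sep_upward [OF _ _ j_mono])
  next
    show "comb_k Aj \<in> sep Aj" "comb_s Aj \<in> sep Aj" "comb_a Aj \<in> sep Aj"
      by (fact comb_k_nucleus_alg comb_s_nucleus_alg comb_a_nucleus_alg)+
  next
    fix a a' b b' assume "a \<in> carrier Aj" "a' \<in> carrier Aj" "b \<in> carrier Aj" "b' \<in> carrier Aj"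
      "le Aj a' a" "le Aj b b'"
    then show "le Aj (imp Aj a b) (imp Aj a' b')"
      unfolding nucleus_alg_simps by (intro imp_mono j_mono) simp_all
  qed (use inf_exists in \<open>simp_all add: nucleus_alg_simps(1,4,5) Lower_nucleus_alg greatest_nucleus_alg
    Collect_restrict\<close>)
qed

lemma id_implicative_nucleus_alg: "implicative_morphism A Aj (id_mor A)"
proof (rule implicative_morphismI [OF arrow_algebra_axioms arrow_algebra_nucleus_alg])
  let ?I = "carrier A \<times> carrier A"
  have p: "fst \<in> ?I \<rightarrow> carrier A" "snd \<in> ?I \<rightarrow> carrier A"
    by auto
  have "entails Aj ?I (\<lambda>x. fst x \<leadsto> snd x) (\<lambda>x. fst x \<leadsto> j (snd x))"
    by (rule entails_imp_entails_nucleus_alg [OF imp_right [OF entails_unit]]) (use p in simp_all)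
  then show "entails Aj ?I (\<lambda>(a, a'). id_mor A (a \<leadsto> a')) (\<lambda>(a, a'). imp Aj (id_mor A a) (id_mor A a'))"
    by (rule entails_cong) (auto simp: id_mor_def nucleus_alg_simps)
next
  fix X :: "('a \<times> 'a) set" assume X: "X \<subseteq> carrier A \<times> carrier A" and u: "entails A X fst snd"
  have "entails Aj X fst snd"
    by (rule entails_imp_entails_nucleus_alg [OF u]) (use X in auto)
  then show "entails Aj X (\<lambda>x. id_mor A (fst x)) (\<lambda>x. id_mor A (snd x))"
    by (rule entails_cong) (use X in \<open>auto simp: id_mor_def\<close>)
qed (use sep_subset_nucleus_alg in \<open>auto simp: id_mor_def nucleus_alg_simps\<close>)

lemma nucleus_implicative:
  assumes ext: "j \<in> extensional (carrier A)"
  shows "implicative_morphism Aj A j"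
proof (rule implicative_morphismI [OF arrow_algebra_nucleus_alg arrow_algebra_axioms])
  show "entails A (carrier Aj \<times> carrier Aj) (\<lambda>(a, a'). j (imp Aj a a')) (\<lambda>(a, a'). j a \<leadsto> j a')"
    unfolding nucleus_alg_simps case_prod_beta by (rule j_imp) auto
next
  fix X :: "('a \<times> 'a) set" assume X: "X \<subseteq> carrier Aj \<times> carrier Aj" and u: "entails Aj X fst snd"
  have p: "fst \<in> X \<rightarrow> carrier A" "snd \<in> X \<rightarrow> carrier A"
    using X by (auto simp: nucleus_alg_simps)
  show "entails A X (\<lambda>x. j (fst x)) (\<lambda>x. j (snd x))"
    using bind [OF _ p] u p by (simp add: entails_nucleus_alg)
qed (use ext in \<open>auto simp: nucleus_alg_simps PiE_def\<close>)

end

section \<open>The arrow construction\<close>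

lemma arrow_of_simps:
  "carrier (arrow_of A) = {x. fst x \<in> carrier A \<and> snd x \<in> carrier A \<and> fst x \<sqsubseteq>\<^bsub>A\<^esub> snd x}"
  "eq (arrow_of A) = (=)"
  "x \<sqsubseteq>\<^bsub>arrow_of A\<^esub> y \<longleftrightarrow> fst x \<sqsubseteq>\<^bsub>A\<^esub> fst y \<and> snd x \<sqsubseteq>\<^bsub>A\<^esub> snd y"
  "x \<leadsto>\<^bsub>arrow_of A\<^esub> y = ((fst x \<leadsto>\<^bsub>A\<^esub> fst y) \<sqinter>\<^bsub>A\<^esub> (snd x \<leadsto>\<^bsub>A\<^esub> snd y), snd x \<leadsto>\<^bsub>A\<^esub> snd y)"
  "sep (arrow_of A) = {x. fst x \<in> sep A \<and> snd x \<in> carrier A \<and> fst x \<sqsubseteq>\<^bsub>A\<^esub> snd x}"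
  by (auto simp: arrow_of_def case_prod_beta)

text \<open>
  The components are numbered by the truth values, with \<open>False\<close> for the lower one, so that an index
  set can be doubled by forming \<open>I \<times> UNIV\<close>. This number has the same type for the two algebras of a
  morphism, which the projections \<open>fst\<close> and \<open>snd\<close> do not.
\<close>

definition component :: "bool \<Rightarrow> 'a \<times> 'a \<Rightarrow> 'a" where
  "component b x = (if b then snd x else fst x)"

lemma component_simps [simp]:
  "component False x = fst x" "component True x = snd x"
  by (simp_all add: component_def)

context binary_implicative
begin

abbreviation Arr :: "('a \<times> 'a) arrow_alg" where "Arr \<equiv> arrow_of A"

lemma Arr_closedI:
  "fst x \<in> carrier A \<Longrightarrow> snd x \<in> carrier A \<Longrightarrow> fst x \<sqsubseteq> snd x \<Longrightarrow> x \<in> carrier Arr"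
  by (simp add: arrow_of_simps)

lemma Arr_imp_closed [simp]:
  "x \<in> carrier Arr \<Longrightarrow> y \<in> carrier Arr \<Longrightarrow> x \<leadsto>\<^bsub>Arr\<^esub> y \<in> carrier Arr"
  by (auto simp: arrow_of_simps intro: meet_right)

lemma sep_Arr_iff: "x \<in> sep Arr \<longleftrightarrow> x \<in> carrier Arr \<and> fst x \<in> sep A"
  by (auto simp: arrow_of_simps)

lemma partial_order_Arr: "partial_order Arr"
  by unfold_locales (auto simp: arrow_of_simps prod_eq_iff intro: le_antisym le_trans)

lemma Arr_closedD [simp]:
  "x \<in> carrier Arr \<Longrightarrow> fst x \<in> carrier A"
  "x \<in> carrier Arr \<Longrightarrow> snd x \<in> carrier A"
  "x \<in> carrier Arr \<Longrightarrow> fst x \<sqsubseteq> snd x"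
  by (simp_all add: arrow_of_simps)

lemma component_closed [simp]: "x \<in> carrier Arr \<Longrightarrow> component b x \<in> carrier A"
  by (cases b) simp_all

lemma snd_imp [simp]: "snd (x \<leadsto>\<^bsub>Arr\<^esub> y) = snd x \<leadsto> snd y"
  by (simp add: arrow_of_simps)

lemma fst_imp: "fst (x \<leadsto>\<^bsub>Arr\<^esub> y) = (fst x \<leadsto> fst y) \<sqinter> (snd x \<leadsto> snd y)"
  by (simp add: arrow_of_simps)

lemma fst_imp_le: "x \<in> carrier Arr \<Longrightarrow> y \<in> carrier Arr \<Longrightarrow> fst (x \<leadsto>\<^bsub>Arr\<^esub> y) \<sqsubseteq> fst x \<leadsto> fst y"
  by (simp add: fst_imp meet_left)

lemma fst_imp_le_component:
  "x \<in> carrier Arr \<Longrightarrow> y \<in> carrier Arr \<Longrightarrow> fst (x \<leadsto>\<^bsub>Arr\<^esub> y) \<sqsubseteq> component b x \<leadsto> component b y"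
  by (cases b) (simp_all add: fst_imp meet_left meet_right)

lemma component_imp_le:
  "x \<in> carrier Arr \<Longrightarrow> y \<in> carrier Arr
    \<Longrightarrow> component b (x \<leadsto>\<^bsub>Arr\<^esub> y) \<sqsubseteq> component b x \<leadsto> component b y"
  by (cases b) (simp_all add: fst_imp_le)

lemma imp_right_le:
  "\<lbrakk>r \<sqsubseteq> a \<leadsto> b; b \<sqsubseteq> b'; r \<in> carrier A; a \<in> carrier A; b \<in> carrier A; b' \<in> carrier A\<rbrakk> \<Longrightarrow> r \<sqsubseteq> a \<leadsto> b'"
  by (rule le_trans [OF _ imp_mono [of a a b b']]) simp_all

lemma imp_left_le:
  "\<lbrakk>r \<sqsubseteq> a \<leadsto> b; a' \<sqsubseteq> a; r \<in> carrier A; a \<in> carrier A; a' \<in> carrier A; b \<in> carrier A\<rbrakk> \<Longrightarrow> r \<sqsubseteq> a' \<leadsto> b"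
  by (rule le_trans [OF _ imp_mono [of a a' b b]]) simp_all

text \<open>
  By binary implicativity the lower component of an iterated implication in \<open>A\<^sup>\<rightarrow>\<close> is a meet of
  iterated implications in \<open>A\<close> whose first antecedents are lower and whose remaining parts are upper
  components. Since \<open>x\<^sub>0 \<sqsubseteq> x\<^sub>1\<close>, each of these lies above the implication between lower components
  or the one between upper components, so only these two have to be bounded from below.
\<close>

lemma le_fst_imp2:
  assumes c: "x \<in> carrier Arr" "y \<in> carrier Arr" "z \<in> carrier Arr" and r: "r \<in> carrier A"
    and 0: "r \<sqsubseteq> fst x \<leadsto> fst y \<leadsto> fst z" and 1: "r \<sqsubseteq> snd x \<leadsto> snd y \<leadsto> snd z"
  shows "r \<sqsubseteq> fst (x \<leadsto>\<^bsub>Arr\<^esub> y \<leadsto>\<^bsub>Arr\<^esub> z)"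
proof -
  have "r \<sqsubseteq> fst x \<leadsto> snd y \<leadsto> snd z"
    by (rule imp_left_le [OF 1]) (use c r in simp_all)
  with 0 1 show ?thesis
    using c r by (simp add: fst_imp imp_meet meet_le)
qed

lemma le_fst_imp3:
  assumes c: "x \<in> carrier Arr" "y \<in> carrier Arr" "z \<in> carrier Arr" "w \<in> carrier Arr"
    and r: "r \<in> carrier A"
    and 0: "r \<sqsubseteq> fst x \<leadsto> fst y \<leadsto> fst z \<leadsto> fst w"
    and 1: "r \<sqsubseteq> snd x \<leadsto> snd y \<leadsto> snd z \<leadsto> snd w"
  shows "r \<sqsubseteq> fst (x \<leadsto>\<^bsub>Arr\<^esub> y \<leadsto>\<^bsub>Arr\<^esub> z \<leadsto>\<^bsub>Arr\<^esub> w)"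
proof -
  have 2: "r \<sqsubseteq> fst x \<leadsto> snd y \<leadsto> snd z \<leadsto> snd w"
    by (rule imp_left_le [OF 1]) (use c r in simp_all)
  have "r \<sqsubseteq> fst x \<leadsto> fst y \<leadsto> snd z \<leadsto> snd w"
    by (rule imp_right_le [OF 2 imp_mono]) (use c r in simp_all)
  with 0 1 2 show ?thesis
    using c r by (simp add: fst_imp imp_meet meet_le)
qed

lemma greatest_Arr:
  assumes X: "X \<subseteq> carrier Arr"
  shows "greatest Arr (\<Sqinter>(fst ` X), \<Sqinter>(snd ` X)) (Lower Arr X)"
proof -
  have sub: "fst ` X \<subseteq> carrier A" "snd ` X \<subseteq> carrier A"
    using X by (intro image_subsetI Arr_closedD; blast)+
  have le: "\<Sqinter>(fst ` X) \<sqsubseteq> fst x" "\<Sqinter>(snd ` X) \<sqsubseteq> snd x" if "x \<in> X" for x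
    using that by (auto intro!: inf_lower sub)
  have "\<Sqinter>(fst ` X) \<sqsubseteq> \<Sqinter>(snd ` X)"
  proof (rule inf_greatest [OF sub(2)])
    fix y assume "y \<in> snd ` X"
    then obtain x where x: "x \<in> X" "y = snd x"
      by blast
    show "\<Sqinter>(fst ` X) \<sqsubseteq> y"
      by (rule le_trans [OF le(1) [OF x(1)]])
        (use x subsetD [OF X x(1)] sub in simp_all)
  qed (use sub in simp)
  then have g: "(\<Sqinter>(fst ` X), \<Sqinter>(snd ` X)) \<in> carrier Arr"
    using sub by (intro Arr_closedI) simp_all
  show ?thesis
    unfolding greatest_def
  proof (intro conjI ballI)
    show "(\<Sqinter>(fst ` X), \<Sqinter>(snd ` X)) \<in> Lower Arr X"
      unfolding Lower_def
    proof (intro IntI CollectI allI impI g)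
      fix x assume "x \<in> X \<inter> carrier Arr"
      then show "(\<Sqinter>(fst ` X), \<Sqinter>(snd ` X)) \<sqsubseteq>\<^bsub>Arr\<^esub> x"
        using le [of x] by (simp add: arrow_of_simps(3))
    qed
  next
    fix y assume y: "y \<in> Lower Arr X"
    then have yc: "y \<in> carrier Arr"
      by (simp add: Lower_def)
    have "fst y \<sqsubseteq> fst x \<and> snd y \<sqsubseteq> snd x" if "x \<in> X" for x
      using Lower_memD [OF y that] X by (simp add: arrow_of_simps(3))
    then show "y \<sqsubseteq>\<^bsub>Arr\<^esub> (\<Sqinter>(fst ` X), \<Sqinter>(snd ` X))"
      using yc sub unfolding arrow_of_simps(3) fst_conv snd_conv
      by (intro conjI inf_greatest) auto
  qed simp
qed

lemma Inf_Arr: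
  assumes "X \<subseteq> carrier Arr"
  shows "\<Sqinter>\<^bsub>Arr\<^esub>X = (\<Sqinter>(fst ` X), \<Sqinter>(snd ` X))"
proof -
  interpret Arr: partial_order Arr
    by (rule partial_order_Arr)
  show ?thesis
    using greatest_Arr [OF assms] Arr.greatest_unique
    unfolding Lattice.inf_def by (metis (no_types, lifting) someI_ex)
qed

lemma Inf_sep_Arr:
  assumes X: "X \<subseteq> carrier Arr" and r: "r \<in> sep A" and le: "\<And>x. x \<in> X \<Longrightarrow> r \<sqsubseteq> fst x"
  shows "\<Sqinter>\<^bsub>Arr\<^esub>X \<in> sep Arr"
proof -
  have "(\<Sqinter>(fst ` X), \<Sqinter>(snd ` X)) \<in> carrier Arr"
    using greatest_Arr [OF X] by (auto simp: greatest_def Lower_def)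
  moreover have "\<Sqinter>(fst ` X) \<in> sep A"
  proof (rule Inf_sep [OF r])
    show "fst ` X \<subseteq> carrier A"
      using X by (intro image_subsetI Arr_closedD) blast
  qed (use le in blast)
  ultimately show ?thesis
    unfolding Inf_Arr [OF X] by (simp add: sep_Arr_iff)
qed

lemma comb_k_Arr: "comb_k Arr \<in> sep Arr"
  unfolding comb_k_def
proof (rule Inf_sep_Arr [OF _ sep_k])
  fix u assume "u \<in> {x \<leadsto>\<^bsub>Arr\<^esub> y \<leadsto>\<^bsub>Arr\<^esub> x | x y. x \<in> carrier Arr \<and> y \<in> carrier Arr}"
  then obtain x y where u: "u = x \<leadsto>\<^bsub>Arr\<^esub> y \<leadsto>\<^bsub>Arr\<^esub> x"
    and c: "x \<in> carrier Arr" "y \<in> carrier Arr"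
    by blast
  show "comb_k A \<sqsubseteq> fst u"
    unfolding u by (rule le_fst_imp2) (use c sep_k comb_k_le in simp_all)
qed (intro subsetI; elim CollectE exE conjE; simp)

lemma comb_s_Arr: "comb_s Arr \<in> sep Arr"
  unfolding comb_s_def
proof (rule Inf_sep_Arr [OF _ sep_s])
  fix u assume "u \<in> {(x \<leadsto>\<^bsub>Arr\<^esub> y \<leadsto>\<^bsub>Arr\<^esub> z) \<leadsto>\<^bsub>Arr\<^esub> (x \<leadsto>\<^bsub>Arr\<^esub> y) \<leadsto>\<^bsub>Arr\<^esub> x \<leadsto>\<^bsub>Arr\<^esub> z | x y z.
     x \<in> carrier Arr \<and> y \<in> carrier Arr \<and> z \<in> carrier Arr}"
  then obtain x y z where u: "u = (x \<leadsto>\<^bsub>Arr\<^esub> y \<leadsto>\<^bsub>Arr\<^esub> z) \<leadsto>\<^bsub>Arr\<^esub> (x \<leadsto>\<^bsub>Arr\<^esub> y) \<leadsto>\<^bsub>Arr\<^esub> x \<leadsto>\<^bsub>Arr\<^esub> z"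
    and c: "x \<in> carrier Arr" "y \<in> carrier Arr" "z \<in> carrier Arr"
    by blast
  have s: "comb_s A \<in> carrier A"
    using sep_s by simp
  have U: "fst (x \<leadsto>\<^bsub>Arr\<^esub> y \<leadsto>\<^bsub>Arr\<^esub> z) \<sqsubseteq> fst x \<leadsto> fst y \<leadsto> fst z"
    by (rule imp_right_le [OF fst_imp_le fst_imp_le]) (use c in simp_all)
  have V: "fst (x \<leadsto>\<^bsub>Arr\<^esub> y) \<sqsubseteq> fst x \<leadsto> fst y"
    by (rule fst_imp_le) (use c in simp_all)
  have "comb_s A \<sqsubseteq> fst (x \<leadsto>\<^bsub>Arr\<^esub> y \<leadsto>\<^bsub>Arr\<^esub> z) \<leadsto> (fst x \<leadsto> fst y) \<leadsto> fst x \<leadsto> fst z"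
    by (rule imp_left_le [OF comb_s_le U]) (use c s in simp_all)
  then have 0: "comb_s A \<sqsubseteq> fst (x \<leadsto>\<^bsub>Arr\<^esub> y \<leadsto>\<^bsub>Arr\<^esub> z) \<leadsto> fst (x \<leadsto>\<^bsub>Arr\<^esub> y) \<leadsto> fst x \<leadsto> fst z"
    by (rule imp_right_le [OF _ imp_mono [OF _ _ _ _ V]]) (use c s in simp_all)
  show "comb_s A \<sqsubseteq> fst u"
    unfolding u by (rule le_fst_imp3 [OF _ _ _ _ s 0]) (use c comb_s_le in simp_all)
qed (intro subsetI; elim CollectE exE conjE; simp)

text \<open>
  The lower component of \<open>\<Sqinter>{y \<leadsto> z | (y, z) \<in> X}\<close> is the meet of the implications between lower
  components and of those between upper components. So for the lower components the combinator of \<open>A\<close>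
  is used with the doubled family \<open>X \<times> UNIV\<close>, which has \<open>\<psi>\<close> and \<open>\<chi>\<close> as its two sides.
\<close>

lemma comb_a_Arr: "comb_a Arr \<in> sep Arr"
  unfolding comb_a_def Setcompr_pairs
proof (rule Inf_sep_Arr [OF _ sep_a])
  let ?U = "\<lambda>x X. (\<lambda>q. x \<leadsto>\<^bsub>Arr\<^esub> fst q \<leadsto>\<^bsub>Arr\<^esub> snd q) ` X"
    and ?W = "\<lambda>X. (\<lambda>q. fst q \<leadsto>\<^bsub>Arr\<^esub> snd q) ` X"
  have sub: "?U x X \<subseteq> carrier Arr" "?W X \<subseteq> carrier Arr"
    if "x \<in> carrier Arr" "X \<subseteq> carrier Arr \<times> carrier Arr" for x X
    using that by auto
  have closed: "\<Sqinter>\<^bsub>Arr\<^esub>(?U x X) \<in> carrier Arr" "\<Sqinter>\<^bsub>Arr\<^esub>(?W X) \<in> carrier Arr"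
    if "x \<in> carrier Arr" "X \<subseteq> carrier Arr \<times> carrier Arr" for x X
    using greatest_Arr [OF sub(1) [OF that]] greatest_Arr [OF sub(2) [OF that]]
    unfolding Inf_Arr [OF sub(1) [OF that]] Inf_Arr [OF sub(2) [OF that]]
    by (auto simp: greatest_def Lower_def)
  show "{\<Sqinter>\<^bsub>Arr\<^esub>(?U x X) \<leadsto>\<^bsub>Arr\<^esub> x \<leadsto>\<^bsub>Arr\<^esub> \<Sqinter>\<^bsub>Arr\<^esub>(?W X) | x X.
      x \<in> carrier Arr \<and> X \<subseteq> carrier Arr \<times> carrier Arr} \<subseteq> carrier Arr"
    using closed by (intro subsetI; elim CollectE exE conjE; simp)
  fix u assume "u \<in> {\<Sqinter>\<^bsub>Arr\<^esub>(?U x X) \<leadsto>\<^bsub>Arr\<^esub> x \<leadsto>\<^bsub>Arr\<^esub> \<Sqinter>\<^bsub>Arr\<^esub>(?W X) | x X.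
      x \<in> carrier Arr \<and> X \<subseteq> carrier Arr \<times> carrier Arr}"
  then obtain x X where u: "u = \<Sqinter>\<^bsub>Arr\<^esub>(?U x X) \<leadsto>\<^bsub>Arr\<^esub> x \<leadsto>\<^bsub>Arr\<^esub> \<Sqinter>\<^bsub>Arr\<^esub>(?W X)"
    and x: "x \<in> carrier Arr" and X: "X \<subseteq> carrier Arr \<times> carrier Arr"
    by blast
  have Xc: "fst q \<in> carrier Arr" "snd q \<in> carrier Arr" if "q \<in> X" for q
    using X that by auto
  have a: "comb_a A \<in> carrier A"
    using sep_a by simp
  let ?K = "X \<times> (UNIV :: bool set)"
  let ?\<psi> = "\<lambda>(q, b). component b (fst q)" and ?\<chi> = "\<lambda>(q, b). component b (snd q)"
  let ?U' = "(\<lambda>k. fst x \<leadsto> ?\<psi> k \<leadsto> ?\<chi> k) ` ?K" and ?W' = "(\<lambda>k. ?\<psi> k \<leadsto> ?\<chi> k) ` ?K"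
  have \<psi>\<chi>: "?\<psi> \<in> ?K \<rightarrow> carrier A" "?\<chi> \<in> ?K \<rightarrow> carrier A"
    by (intro Pi_I; elim SigmaE; simp add: Xc)+
  have U': "?U' \<subseteq> carrier A" and W': "?W' \<subseteq> carrier A"
    using \<psi>\<chi> x unfolding image_subset_iff Pi_iff by simp_all
  have UW1: "snd (\<Sqinter>\<^bsub>Arr\<^esub>(?U x X)) = \<Sqinter>((\<lambda>q. snd x \<leadsto> snd (fst q) \<leadsto> snd (snd q)) ` X)"
    "snd (\<Sqinter>\<^bsub>Arr\<^esub>(?W X)) = \<Sqinter>((\<lambda>q. snd (fst q) \<leadsto> snd (snd q)) ` X)"
    using sub [OF x X] by (simp_all add: Inf_Arr image_image)
  have UW0: "fst (\<Sqinter>\<^bsub>Arr\<^esub>(?U x X)) = \<Sqinter>((\<lambda>q. fst (x \<leadsto>\<^bsub>Arr\<^esub> fst q \<leadsto>\<^bsub>Arr\<^esub> snd q)) ` X)"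
    "fst (\<Sqinter>\<^bsub>Arr\<^esub>(?W X)) = \<Sqinter>((\<lambda>q. fst (fst q \<leadsto>\<^bsub>Arr\<^esub> snd q)) ` X)"
    using sub [OF x X] by (simp_all add: Inf_Arr image_image)
  have 1: "comb_a A \<sqsubseteq> snd (\<Sqinter>\<^bsub>Arr\<^esub>(?U x X)) \<leadsto> snd x \<leadsto> snd (\<Sqinter>\<^bsub>Arr\<^esub>(?W X))"
    unfolding UW1 by (rule comb_a_le) (simp_all add: Pi_iff x Xc)
  have U0: "fst (\<Sqinter>\<^bsub>Arr\<^esub>(?U x X)) \<sqsubseteq> \<Sqinter>?U'"
  proof (rule inf_greatest [OF U'])
    fix t assume "t \<in> ?U'"
    then obtain q b where q: "q \<in> X"
      and t: "t = fst x \<leadsto> component b (fst q) \<leadsto> component b (snd q)"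
      by (elim imageE SigmaE) simp
    let ?v = "fst q \<leadsto>\<^bsub>Arr\<^esub> snd q"
    have "fst (\<Sqinter>\<^bsub>Arr\<^esub>(?U x X)) \<sqsubseteq> fst (x \<leadsto>\<^bsub>Arr\<^esub> ?v)"
      unfolding UW0 by (rule inf_lower [OF _ imageI [OF q]]) (simp add: image_subset_iff x Xc)
    also have "fst (x \<leadsto>\<^bsub>Arr\<^esub> ?v) \<sqsubseteq> t"
      unfolding t by (rule imp_right_le [OF fst_imp_le fst_imp_le_component])
        (use x Xc [OF q] in simp_all)
    finally show "fst (\<Sqinter>\<^bsub>Arr\<^esub>(?U x X)) \<sqsubseteq> t"
      using closed [OF x X] x Xc [OF q] t by simp
  qed (use closed [OF x X] in simp)
  have W0: "\<Sqinter>?W' \<sqsubseteq> fst (\<Sqinter>\<^bsub>Arr\<^esub>(?W X))"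
    unfolding UW0
  proof (rule inf_greatest)
    fix t assume "t \<in> (\<lambda>q. fst (fst q \<leadsto>\<^bsub>Arr\<^esub> snd q)) ` X"
    then obtain q where q: "q \<in> X" and t: "t = fst (fst q \<leadsto>\<^bsub>Arr\<^esub> snd q)"
      by blast
    have "\<Sqinter>?W' \<sqsubseteq> component b (fst q) \<leadsto> component b (snd q)" for b
      by (rule inf_lower [OF W']) (use q in \<open>simp add: rev_image_eqI [of "(q, b)"]\<close>)
    from this [of False] this [of True] have "\<Sqinter>?W' \<sqsubseteq> fst (fst q) \<leadsto> fst (snd q)"
      "\<Sqinter>?W' \<sqsubseteq> snd (fst q) \<leadsto> snd (snd q)"
      by simp_all
    then show "\<Sqinter>?W' \<sqsubseteq> t"
      unfolding t fst_imp using Xc [OF q] W' by (intro meet_le) simp_all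
  qed (use W' in \<open>simp_all add: image_subset_iff Xc\<close>)
  have "comb_a A \<sqsubseteq> fst (\<Sqinter>\<^bsub>Arr\<^esub>(?U x X)) \<leadsto> fst x \<leadsto> \<Sqinter>?W'"
    by (rule imp_left_le [OF comb_a_le [OF _ \<psi>\<chi>] U0]) (use x closed [OF x X] a U' W' in simp_all)
  then have 0: "comb_a A \<sqsubseteq> fst (\<Sqinter>\<^bsub>Arr\<^esub>(?U x X)) \<leadsto> fst x \<leadsto> fst (\<Sqinter>\<^bsub>Arr\<^esub>(?W X))"
    by (rule imp_right_le [OF _ imp_mono [OF _ _ _ _ _ W0]])
      (use x closed [OF x X] a W' in simp_all)
  show "comb_a A \<sqsubseteq> fst u"
    unfolding u by (rule le_fst_imp2 [OF _ _ _ a 0 1]) (use x closed [OF x X] in simp_all)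
qed

lemma arrow_algebra_Arr: "arrow_algebra Arr"
proof -
  interpret Arr: partial_order Arr
    by (rule partial_order_Arr)
  show ?thesis
  proof
    show "\<exists>i. greatest Arr i (Lower Arr X)" if "X \<subseteq> carrier Arr" for X
      using greatest_Arr [OF that] by blast
  next
    fix x y assume "x \<in> carrier Arr" "y \<in> carrier Arr"
    then show "x \<leadsto>\<^bsub>Arr\<^esub> y \<in> carrier Arr"
      by (rule Arr_imp_closed)
  next
    fix x x' y y' assume c: "x \<in> carrier Arr" "x' \<in> carrier Arr" "y \<in> carrier Arr" "y' \<in> carrier Arr"
      and le: "x' \<sqsubseteq>\<^bsub>Arr\<^esub> x" "y \<sqsubseteq>\<^bsub>Arr\<^esub> y'"
    have "fst x \<leadsto> fst y \<sqsubseteq> fst x' \<leadsto> fst y'" "snd x \<leadsto> snd y \<sqsubseteq> snd x' \<leadsto> snd y'"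
      using le c unfolding arrow_of_simps(3) by (auto intro!: imp_mono)
    moreover have "fst (x \<leadsto>\<^bsub>Arr\<^esub> y) \<sqsubseteq> fst x' \<leadsto> fst y'" "fst (x \<leadsto>\<^bsub>Arr\<^esub> y) \<sqsubseteq> snd x' \<leadsto> snd y'"
      unfolding fst_imp
      by (rule le_trans [OF meet_left] le_trans [OF meet_right], use c calculation in simp_all)+
    ultimately show "x \<leadsto>\<^bsub>Arr\<^esub> y \<sqsubseteq>\<^bsub>Arr\<^esub> x' \<leadsto>\<^bsub>Arr\<^esub> y'"
      unfolding arrow_of_simps(3) fst_imp [of x' y'] using c by (simp add: meet_le)
  next
    show "sep Arr \<subseteq> carrier Arr"
      by (auto simp: sep_Arr_iff)
  next
    fix x y assume "x \<in> sep Arr" "y \<in> carrier Arr" "x \<sqsubseteq>\<^bsub>Arr\<^esub> y"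
    then show "y \<in> sep Arr"
      using sep_upward [of "fst x" "fst y"] by (simp add: sep_Arr_iff arrow_of_simps(3))
  next
    fix x y assume c: "x \<in> carrier Arr" "y \<in> carrier Arr" and s: "x \<leadsto>\<^bsub>Arr\<^esub> y \<in> sep Arr" "x \<in> sep Arr"
    have "fst (x \<leadsto>\<^bsub>Arr\<^esub> y) \<in> sep A" and x: "fst x \<in> sep A"
      using s by (auto simp: sep_Arr_iff)
    then have "fst x \<leadsto> fst y \<in> sep A"
      by (rule_tac sep_upward [OF _ _ fst_imp_le]) (use c in simp_all)
    then have "fst y \<in> sep A"
      by (rule sep_mp [rotated 2]) (use c x in simp_all)
    then show "y \<in> sep Arr"
      using c by (simp add: sep_Arr_iff)
  qed (fact comb_k_Arr comb_s_Arr comb_a_Arr)+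
qed

text \<open>
  Entailment in \<open>A\<^sup>\<rightarrow>\<close> asks for one realizer in \<open>A\<close> that works for both components, which is more
  than an entailment of the lower and one of the upper components. A realizer \<open>r\<close> in \<open>A\<close> gives the
  realizer \<open>(r, r)\<close> in \<open>A\<^sup>\<rightarrow>\<close>.
\<close>

lemma entails_Arr:
  assumes c: "\<phi> \<in> I \<rightarrow> carrier Arr" "\<psi> \<in> I \<rightarrow> carrier Arr"
  shows "entails Arr I \<phi> \<psi> \<longleftrightarrow>
    entails A (I \<times> UNIV) (\<lambda>(i, b). component b (\<phi> i)) (\<lambda>(i, b). component b (\<psi> i))"
    (is "_ \<longleftrightarrow> ?R")
proof
  have ci: "\<phi> i \<in> carrier Arr" "\<psi> i \<in> carrier Arr" if "i \<in> I" for i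
    using c that by auto
  show ?R if h: "entails Arr I \<phi> \<psi>"
  proof -
    obtain r where "r \<in> sep Arr" "\<And>i. i \<in> I \<Longrightarrow> r \<sqsubseteq>\<^bsub>Arr\<^esub> \<phi> i \<leadsto>\<^bsub>Arr\<^esub> \<psi> i"
      using h unfolding entails_def by blast
    then have r: "fst r \<in> sep A" "\<And>i. i \<in> I \<Longrightarrow> fst r \<sqsubseteq> fst (\<phi> i \<leadsto>\<^bsub>Arr\<^esub> \<psi> i)"
      by (simp_all add: sep_Arr_iff arrow_of_simps(3))
    have "fst r \<sqsubseteq> component b (\<phi> i) \<leadsto> component b (\<psi> i)" if i: "i \<in> I" for i b
      by (rule le_trans [OF r(2) [OF i] fst_imp_le_component]) (use ci [OF i] r(1) in simp_all)
    with r(1) show ?thesis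
      unfolding entails_def by (intro bexI [of _ "fst r"]) auto
  qed
  show "entails Arr I \<phi> \<psi>" if h: ?R
  proof -
    obtain r where r: "r \<in> sep A" "\<And>i b. i \<in> I \<Longrightarrow> r \<sqsubseteq> component b (\<phi> i) \<leadsto> component b (\<psi> i)"
      using h unfolding entails_def by auto
    have "r \<sqsubseteq> fst (\<phi> i \<leadsto>\<^bsub>Arr\<^esub> \<psi> i)" "r \<sqsubseteq> snd (\<phi> i \<leadsto>\<^bsub>Arr\<^esub> \<psi> i)" if i: "i \<in> I" for i
      using r(1) r(2) [OF i, of False] r(2) [OF i, of True] ci [OF i] by (auto simp: fst_imp meet_le)
    with r(1) show ?thesis
      unfolding entails_def by (intro bexI [of _ "(r, r)"]) (auto simp: arrow_of_simps(3,5))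
  qed
qed

text \<open>
  With an implication on the right, \<open>entails_Arr\<close> alone would leave a binary meet in the lower
  component; by \<open>le_fst_imp2\<close> it is enough to treat each component separately.
\<close>

lemma entails_Arr_imp:
  assumes c: "\<phi> \<in> I \<rightarrow> carrier Arr" "\<psi> \<in> I \<rightarrow> carrier Arr" "\<chi> \<in> I \<rightarrow> carrier Arr"
    and "entails A (I \<times> UNIV) (\<lambda>(i, b). component b (\<phi> i))
      (\<lambda>(i, b). component b (\<psi> i) \<leadsto> component b (\<chi> i))"
  shows "entails Arr I \<phi> (\<lambda>i. \<psi> i \<leadsto>\<^bsub>Arr\<^esub> \<chi> i)"
proof -
  obtain r where r: "r \<in> sep A"
    "\<And>i b. i \<in> I \<Longrightarrow> r \<sqsubseteq> component b (\<phi> i) \<leadsto> component b (\<psi> i) \<leadsto> component b (\<chi> i)"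
    using assms(4) unfolding entails_def by auto
  have "r \<sqsubseteq> fst (\<phi> i \<leadsto>\<^bsub>Arr\<^esub> \<psi> i \<leadsto>\<^bsub>Arr\<^esub> \<chi> i)" "r \<sqsubseteq> snd (\<phi> i \<leadsto>\<^bsub>Arr\<^esub> \<psi> i \<leadsto>\<^bsub>Arr\<^esub> \<chi> i)" if i: "i \<in> I" for i
    using r(1) r(2) [OF i, of False] r(2) [OF i, of True] c i by (auto intro!: le_fst_imp2)
  with r(1) show ?thesis
    unfolding entails_def by (intro bexI [of _ "(r, r)"]) (auto simp: arrow_of_simps(3,5))
qed

end

section \<open>The action of the arrow construction on morphisms\<close>

text \<open>
  An implicative morphism need not be monotone, so applying it componentwise can leave \<open>A\<^sup>\<rightarrow>\<close>. The
  monotone hull repairs this without changing the morphism up to isomorphism, and \<open>f\<^sup>\<rightarrow>\<close> is the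
  componentwise action of the hull.
\<close>

definition monotone_hull :: "'a arrow_alg \<Rightarrow> 'b arrow_alg \<Rightarrow> ('a \<Rightarrow> 'b) \<Rightarrow> 'a \<Rightarrow> 'b" where
  "monotone_hull A B f =
    (\<lambda>x \<in> carrier A. \<Sqinter>\<^bsub>B\<^esub>{delta B (f a) | a. a \<in> carrier A \<and> x \<sqsubseteq>\<^bsub>A\<^esub> a})"

context implicative_morphism
begin

abbreviation hull :: "'a \<Rightarrow> 'b" where "hull \<equiv> monotone_hull A B f"

lemma hull_eq: "x \<in> carrier A \<Longrightarrow>
    hull x = \<Sqinter>\<^bsub>B\<^esub>((\<lambda>a. \<top>\<^bsub>B\<^esub> \<leadsto>\<^bsub>B\<^esub> f a) ` {a \<in> carrier A. x \<sqsubseteq>\<^bsub>A\<^esub> a})"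
  by (simp add: monotone_hull_def delta_def image_Collect)

lemma hull_set: "(\<lambda>a. \<top>\<^bsub>B\<^esub> \<leadsto>\<^bsub>B\<^esub> f a) ` {a \<in> carrier A. x \<sqsubseteq>\<^bsub>A\<^esub> a} \<subseteq> carrier B"
  by auto

lemma hull_closed [simp]: "x \<in> carrier A \<Longrightarrow> hull x \<in> carrier B"
  by (simp add: hull_eq hull_set)

lemma hull_ext: "hull \<in> carrier A \<rightarrow>\<^sub>E carrier B"
  by (rule PiE_I) (simp, simp add: monotone_hull_def)

lemma hull_mono:
  assumes "x \<in> carrier A" "y \<in> carrier A" "x \<sqsubseteq>\<^bsub>A\<^esub> y"
  shows "hull x \<sqsubseteq>\<^bsub>B\<^esub> hull y"
proof -
  have "{a \<in> carrier A. y \<sqsubseteq>\<^bsub>A\<^esub> a} \<subseteq> {a \<in> carrier A. x \<sqsubseteq>\<^bsub>A\<^esub> a}"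
    using assms A.le_trans by blast
  then show ?thesis
    unfolding hull_eq [OF assms(1)] hull_eq [OF assms(2)]
    by (intro B.inf_greatest B.inf_lower hull_set) (use hull_set in auto)
qed

text \<open>
  For \<open>x \<sqsubseteq> a\<close> one has \<open>x \<turnstile> a\<close> uniformly in the pair, hence \<open>f x \<turnstile> f a\<close> because \<open>f\<close> preserves
  entailments. The factor \<open>\<top> \<leadsto>\<close> in the hull turns \<open>f a\<close> into an implication, so that the meet over
  \<open>a\<close> can be taken on the right.
\<close>

lemma entails_hull: "entails B (carrier A) f hull"
proof -
  let ?J = "\<lambda>x. {a \<in> carrier A. x \<sqsubseteq>\<^bsub>A\<^esub> a}"
  let ?S = "SIGMA x:carrier A. ?J x"
  have p: "fst \<in> ?S \<rightarrow> carrier A" "snd \<in> ?S \<rightarrow> carrier A"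
    by auto
  have "entails A ?S fst snd"
    by (rule A.entails_le) auto
  then have "entails B ?S (\<lambda>k. f (fst k)) (\<lambda>k. f (snd k))"
    using p by (rule map_entails)
  then have "entails B ?S (\<lambda>k. f (fst k)) (\<lambda>k. \<top>\<^bsub>B\<^esub> \<leadsto>\<^bsub>B\<^esub> f (snd k))"
    by (rule B.entails_trans [OF _ B.entails_k]) (use p in simp_all)
  then have "entails B (carrier A) f (\<lambda>x. \<Sqinter>\<^bsub>B\<^esub>((\<lambda>a. \<top>\<^bsub>B\<^esub> \<leadsto>\<^bsub>B\<^esub> f a) ` ?J x))"
    by (intro B.entails_Inf) (simp_all add: case_prod_unfold map_Pi Pi_iff)
  then show ?thesis
    by (rule entails_cong) (simp_all add: hull_eq)
qed

lemma hull_entails: "entails B (carrier A) hull f"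
proof -
  have "hull x \<sqsubseteq>\<^bsub>B\<^esub> delta B (f x)" if x: "x \<in> carrier A" for x
    unfolding hull_eq [OF x] delta_def by (rule B.inf_lower [OF hull_set]) (use x in simp)
  then have "entails B (carrier A) hull (\<lambda>x. delta B (f x))"
    by (rule B.entails_le) auto
  then show ?thesis
    by (rule B.entails_trans [OF _ B.delta_entails]) auto
qed

lemma hull_implicative: "implicative_morphism A B hull"
  by (rule implicative_morphism_iso [OF implicative_morphism_axioms hull_ext entails_hull hull_entails])

end

locale binary_implicative_morphism =
  implicative_morphism A B f + A: binary_implicative A + B: binary_implicative B
  for A :: "'a arrow_alg" and B :: "'b arrow_alg" and f
begin

abbreviation arr :: "'a \<times> 'a \<Rightarrow> 'b \<times> 'b" where "arr \<equiv> arrow_mor A B f"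

lemma arr_eq: "x \<in> carrier A.Arr \<Longrightarrow> arr x = (hull (fst x), hull (snd x))"
  by (simp add: arrow_mor_def monotone_hull_def case_prod_beta)

lemma component_arr: "x \<in> carrier A.Arr \<Longrightarrow> component b (arr x) = hull (component b x)"
  by (cases b) (simp_all add: arr_eq)

lemma arr_closed [simp]: "x \<in> carrier A.Arr \<Longrightarrow> arr x \<in> carrier B.Arr"
  by (rule B.Arr_closedI) (simp_all add: arr_eq hull_mono)

lemma arr_ext: "arr \<in> carrier A.Arr \<rightarrow>\<^sub>E carrier B.Arr"
  by (rule PiE_I) (simp, simp add: arrow_mor_def)

lemma arr_implicative: "implicative_morphism A.Arr B.Arr arr"
proof -
  interpret h: implicative_morphism A B hull
    by (rule hull_implicative)
  show ?thesis
  proof (rule implicative_morphismI [OF A.arrow_algebra_Arr B.arrow_algebra_Arr arr_ext])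
    fix x assume "x \<in> sep A.Arr"
    then show "arr x \<in> sep B.Arr"
      by (simp add: A.sep_Arr_iff B.sep_Arr_iff) (simp add: arr_eq h.map_sep)
  next
    let ?I = "carrier A.Arr \<times> carrier A.Arr"
    let ?K = "?I \<times> (UNIV :: bool set)"
    let ?x = "\<lambda>k. component (snd k) (fst (fst k))" and ?y = "\<lambda>k. component (snd k) (snd (fst k))"
      and ?xy = "\<lambda>k. component (snd k) (fst (fst k) \<leadsto>\<^bsub>A.Arr\<^esub> snd (fst k))"
    have c: "?x \<in> ?K \<rightarrow> carrier A" "?y \<in> ?K \<rightarrow> carrier A" "?xy \<in> ?K \<rightarrow> carrier A"
      by (intro Pi_I; elim SigmaE; simp)+
    have "entails A ?K ?xy (\<lambda>k. ?x k \<leadsto>\<^bsub>A\<^esub> ?y k)"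
      by (rule A.entails_le; (elim SigmaE)?; simp add: c A.component_imp_le)
    then have "entails B ?K (\<lambda>k. hull (?xy k)) (\<lambda>k. hull (?x k \<leadsto>\<^bsub>A\<^esub> ?y k))"
      by (rule h.map_entails) (use c in simp_all)
    then have "entails B ?K (\<lambda>k. hull (?xy k)) (\<lambda>k. hull (?x k) \<leadsto>\<^bsub>B\<^esub> hull (?y k))"
      by (rule B.entails_trans [OF _ h.map_imp_entails]) (use c in simp_all)
    then have "entails B ?K (\<lambda>(i, b). component b (arr (fst i \<leadsto>\<^bsub>A.Arr\<^esub> snd i)))
        (\<lambda>(i, b). component b (arr (fst i)) \<leadsto>\<^bsub>B\<^esub> component b (arr (snd i)))"
      by (rule entails_cong; elim SigmaE; simp add: component_arr)
    then have "entails B.Arr ?I (\<lambda>i. arr (fst i \<leadsto>\<^bsub>A.Arr\<^esub> snd i))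
        (\<lambda>i. arr (fst i) \<leadsto>\<^bsub>B.Arr\<^esub> arr (snd i))"
      by (rule B.entails_Arr_imp [rotated 3]) (simp_all add: Pi_iff)
    then show "entails B.Arr ?I (\<lambda>(x, y). arr (x \<leadsto>\<^bsub>A.Arr\<^esub> y)) (\<lambda>(x, y). arr x \<leadsto>\<^bsub>B.Arr\<^esub> arr y)"
      by (simp add: case_prod_unfold)
  next
    fix X :: "(('a \<times> 'a) \<times> 'a \<times> 'a) set"
    assume X: "X \<subseteq> carrier A.Arr \<times> carrier A.Arr" and u: "entails A.Arr X fst snd"
    have q: "fst q \<in> carrier A.Arr" "snd q \<in> carrier A.Arr" if "q \<in> X" for q
      using X that by auto
    have c: "fst \<in> X \<rightarrow> carrier A.Arr" "snd \<in> X \<rightarrow> carrier A.Arr"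
      by (simp_all add: Pi_iff q)
    have "entails B (X \<times> UNIV) (\<lambda>k. hull (case k of (i, b) \<Rightarrow> component b (fst i)))
        (\<lambda>k. hull (case k of (i, b) \<Rightarrow> component b (snd i)))"
      using u unfolding A.entails_Arr [OF c]
      by (rule h.map_entails) (intro Pi_I; elim SigmaE; simp add: q)+
    then have "entails B (X \<times> UNIV) (\<lambda>(i, b). component b (arr (fst i)))
        (\<lambda>(i, b). component b (arr (snd i)))"
      by (rule entails_cong; elim SigmaE; simp add: component_arr q)
    then show "entails B.Arr X (\<lambda>x. arr (fst x)) (\<lambda>x. arr (snd x))"
      by (subst B.entails_Arr) (simp_all add: Pi_iff q)
  qed
qed

end

text \<open>
  Maps into an arrow construction that act by the same map on both components inherit entailments
  from it. Applied to monotone hulls, this reduces each law of the arrow construction to the same law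
  for hulls, where it holds because hulls are isomorphic to the given morphisms.
\<close>

lemma (in binary_implicative) entails_componentwise:
  assumes "entails A (carrier C) h k"
    and c: "F \<in> carrier (arrow_of C) \<rightarrow> carrier Arr" "G \<in> carrier (arrow_of C) \<rightarrow> carrier Arr"
    and F: "\<And>x b. x \<in> carrier (arrow_of C) \<Longrightarrow> component b (F x) = h (component b x)"
    and G: "\<And>x b. x \<in> carrier (arrow_of C) \<Longrightarrow> component b (G x) = k (component b x)"
  shows "entails Arr (carrier (arrow_of C)) F G"
  unfolding entails_Arr [OF c]
proof (rule entails_cong)
  show "entails A (carrier (arrow_of C) \<times> UNIV) (\<lambda>i. h (case i of (x, b) \<Rightarrow> component b x))
      (\<lambda>i. k (case i of (x, b) \<Rightarrow> component b x))"
    by (rule entails_reindex [OF assms(1)]) (auto simp: arrow_of_simps component_def)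
qed (elim SigmaE; simp add: F G)+

lemma arrow_mor_mono:
  assumes "binary_implicative_morphism A B f" "binary_implicative_morphism A B g"
    and fg: "entails B (carrier A) f g"
  shows "entails (arrow_of B) (carrier (arrow_of A)) (arrow_mor A B f) (arrow_mor A B g)"
proof -
  interpret f: binary_implicative_morphism A B f by fact
  interpret g: binary_implicative_morphism A B g by fact
  have "entails B (carrier A) f.hull g.hull"
    by (rule f.B.entails_trans [OF f.B.entails_trans [OF f.hull_entails fg] g.entails_hull]) auto
  then show ?thesis
    by (rule f.B.entails_componentwise) (simp_all add: Pi_iff f.component_arr g.component_arr)
qed

lemma arrow_mor_id:
  assumes "binary_implicative A"
  shows "entails (arrow_of A) (carrier (arrow_of A)) (\<lambda>x. x) (arrow_mor A A (id_mor A))"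
    and "entails (arrow_of A) (carrier (arrow_of A)) (arrow_mor A A (id_mor A)) (\<lambda>x. x)"
proof -
  interpret binary_implicative A by fact
  interpret i: binary_implicative_morphism A A "id_mor A"
    by (intro binary_implicative_morphism.intro id_mor_implicative assms arrow_algebra_axioms)
  have i: "entails A (carrier A) (\<lambda>a. a) i.hull" "entails A (carrier A) i.hull (\<lambda>a. a)"
    by (rule entails_cong [OF i.entails_hull] entails_cong [OF i.hull_entails]; simp add: id_mor_def)+
  show "entails Arr (carrier Arr) (\<lambda>x. x) i.arr" "entails Arr (carrier Arr) i.arr (\<lambda>x. x)"
    by (rule entails_componentwise [OF i(1)] entails_componentwise [OF i(2)];
        simp add: i.component_arr Pi_iff)+
qed

lemma arrow_mor_compose:
  assumes "binary_implicative_morphism A B f" "binary_implicative_morphism B C g"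
  shows "entails (arrow_of C) (carrier (arrow_of A))
      (\<lambda>x. arrow_mor B C g (arrow_mor A B f x)) (arrow_mor A C (compose (carrier A) g f))"
    and "entails (arrow_of C) (carrier (arrow_of A))
      (arrow_mor A C (compose (carrier A) g f)) (\<lambda>x. arrow_mor B C g (arrow_mor A B f x))"
proof -
  interpret f: binary_implicative_morphism A B f by fact
  interpret g: binary_implicative_morphism B C g by fact
  interpret gf: binary_implicative_morphism A C "compose (carrier A) g f"
    by (intro binary_implicative_morphism.intro compose_implicative [where B = B]
        f.implicative_morphism_axioms g.implicative_morphism_axioms
        f.A.binary_implicative_axioms g.B.binary_implicative_axioms)
  have c: "(\<lambda>a. g (f a)) \<in> carrier A \<rightarrow> carrier C" "(\<lambda>a. g (f.hull a)) \<in> carrier A \<rightarrow> carrier C"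
    "(\<lambda>a. g.hull (f.hull a)) \<in> carrier A \<rightarrow> carrier C" "gf.hull \<in> carrier A \<rightarrow> carrier C"
    "f.hull \<in> carrier A \<rightarrow> carrier B"
    by auto
  have 1: "entails C (carrier A) (\<lambda>a. g.hull (f.hull a)) (\<lambda>a. g (f.hull a))"
    and 4: "entails C (carrier A) (\<lambda>a. g (f.hull a)) (\<lambda>a. g.hull (f.hull a))"
    by (rule entails_reindex [OF g.hull_entails c(5)] entails_reindex [OF g.entails_hull c(5)])+
  have 2: "entails C (carrier A) (\<lambda>a. g (f.hull a)) (\<lambda>a. g (f a))"
    and 5: "entails C (carrier A) (\<lambda>a. g (f a)) (\<lambda>a. g (f.hull a))"
    by (rule g.map_entails [OF f.hull_entails c(5) f.map_Pi]
        g.map_entails [OF f.entails_hull f.map_Pi c(5)])+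
  have 3: "entails C (carrier A) (\<lambda>a. g (f a)) gf.hull"
    and 6: "entails C (carrier A) gf.hull (\<lambda>a. g (f a))"
    by (rule entails_cong [OF gf.entails_hull] entails_cong [OF gf.hull_entails]; simp add: compose_eq)+
  have "entails C (carrier A) (\<lambda>a. g.hull (f.hull a)) gf.hull"
    by (rule g.B.entails_trans [OF g.B.entails_trans [OF 1 2] 3]) (fact c)+
  then show "entails g.B.Arr (carrier f.A.Arr) (\<lambda>x. g.arr (f.arr x)) gf.arr"
    by (rule g.B.entails_componentwise) (simp_all add: Pi_iff f.component_arr g.component_arr gf.component_arr)
  have "entails C (carrier A) gf.hull (\<lambda>a. g.hull (f.hull a))"
    by (rule g.B.entails_trans [OF g.B.entails_trans [OF 6 5] 4]) (fact c)+
  then show "entails g.B.Arr (carrier f.A.Arr) gf.arr (\<lambda>x. g.arr (f.arr x))"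
    by (rule g.B.entails_componentwise) (simp_all add: Pi_iff f.component_arr g.component_arr gf.component_arr)
qed

section \<open>The nucleus of the modification\<close>

context arrow_algebra
begin

context
  fixes e assumes e [simp]: "e \<in> carrier A"
begin

lemma log_join_eq:
  "log_join A x e = \<Sqinter>((\<lambda>z. (x \<leadsto> z) \<leadsto> (e \<leadsto> z) \<leadsto> z) ` carrier A)"
  by (simp add: log_join_def Setcompr_eq_image)

lemma log_join_closed [simp]: "x \<in> carrier A \<Longrightarrow> log_join A x e \<in> carrier A"
  unfolding log_join_eq by (rule inf_closed) auto

lemma log_join_elim:
  "x \<in> carrier A \<Longrightarrow> z \<in> carrier A \<Longrightarrow> log_join A x e \<sqsubseteq> (x \<leadsto> z) \<leadsto> (e \<leadsto> z) \<leadsto> z"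
  unfolding log_join_eq by (rule inf_lower) auto

lemma entails_log_join_elim:
  assumes "\<phi> \<in> I \<rightarrow> carrier A" "\<chi> \<in> I \<rightarrow> carrier A"
  shows "entails A I (\<lambda>i. log_join A (\<phi> i) e) (\<lambda>i. (\<phi> i \<leadsto> \<chi> i) \<leadsto> (e \<leadsto> \<chi> i) \<leadsto> \<chi> i)"
  by (rule entails_le) (use assms in \<open>auto intro!: log_join_elim simp: Pi_iff\<close>)

text \<open>
  The meet in the encoding of the join ranges over implications, so it can be introduced on the right.
\<close>

lemma entails_log_join_left: "entails A (carrier A) (\<lambda>a. a) (\<lambda>a. log_join A a e)"
proof -
  let ?S = "carrier A \<times> carrier A"
  have p: "fst \<in> ?S \<rightarrow> carrier A" "snd \<in> ?S \<rightarrow> carrier A"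
    by auto
  have "entails A ?S fst (\<lambda>k. (fst k \<leadsto> snd k) \<leadsto> (e \<leadsto> snd k) \<leadsto> snd k)"
    by (rule entails_trans [OF imp_eval imp_right [OF entails_k]]) (use p in simp_all)
  then show ?thesis
    unfolding log_join_eq by (intro entails_Inf) (simp_all add: case_prod_unfold)
qed

lemma entails_log_join_right: "entails A (carrier A) (\<lambda>a. e) (\<lambda>a. log_join A a e)"
proof -
  let ?S = "carrier A \<times> carrier A"
  have p: "fst \<in> ?S \<rightarrow> carrier A" "snd \<in> ?S \<rightarrow> carrier A"
    by auto
  have "entails A ?S (\<lambda>_. e) (\<lambda>k. (fst k \<leadsto> snd k) \<leadsto> (e \<leadsto> snd k) \<leadsto> snd k)"
    by (rule entails_trans [OF imp_eval entails_k]) (use p in simp_all)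
  then show ?thesis
    unfolding log_join_eq by (intro entails_Inf) (simp_all add: case_prod_unfold)
qed

text \<open>
  The condition on \<open>(a \<leadsto> j b) \<leadsto> j a \<leadsto> j b\<close> is the elimination rule of the join \<open>j a\<close>, with
  \<open>j b\<close> as its conclusion; the remaining premise \<open>e \<leadsto> j b\<close> is valid.
\<close>

lemma log_join_nucleus: "nucleus A (\<lambda>x \<in> carrier A. log_join A x e)"
proof
  fix a b assume ab: "a \<in> carrier A" "b \<in> carrier A" "a \<sqsubseteq> b"
  have "log_join A a e \<sqsubseteq> (b \<leadsto> z) \<leadsto> (e \<leadsto> z) \<leadsto> z" if z: "z \<in> carrier A" for z
    by (rule le_trans [OF log_join_elim [OF ab(1) z] imp_mono]) (use ab z in \<open>auto intro!: imp_mono\<close>)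
  then have "log_join A a e \<sqsubseteq> log_join A b e"
    unfolding log_join_eq [of b] using ab by (intro inf_greatest) auto
  then show "(\<lambda>x \<in> carrier A. log_join A x e) a \<sqsubseteq> (\<lambda>x \<in> carrier A. log_join A x e) b"
    using ab by simp
next
  show "entails A (carrier A) (\<lambda>a. a) (\<lambda>x \<in> carrier A. log_join A x e)"
    by (rule entails_cong [OF entails_log_join_left]) simp_all
next
  let ?S = "carrier A \<times> carrier A" and ?j = "\<lambda>a. log_join A a e"
  have p: "fst \<in> ?S \<rightarrow> carrier A" "snd \<in> ?S \<rightarrow> carrier A"
    "(\<lambda>k. ?j (fst k)) \<in> ?S \<rightarrow> carrier A" "(\<lambda>k. ?j (snd k)) \<in> ?S \<rightarrow> carrier A"
    by auto
  have "entails A ?S (\<lambda>k. ?j (fst k)) (\<lambda>k. (fst k \<leadsto> ?j (snd k)) \<leadsto> (e \<leadsto> ?j (snd k)) \<leadsto> ?j (snd k))"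
    by (rule entails_log_join_elim) (use p in simp_all)
  then have 1: "entails A ?S (\<lambda>k. fst k \<leadsto> ?j (snd k)) (\<lambda>k. ?j (fst k) \<leadsto> (e \<leadsto> ?j (snd k)) \<leadsto> ?j (snd k))"
    by (rule swap) (use p in simp_all)
  have "entails A ?S (\<lambda>k. e) (\<lambda>k. ?j (snd k))"
    by (rule entails_reindex [OF entails_log_join_right p(2)])
  then have 2: "entails A ?S (\<lambda>k. (e \<leadsto> ?j (snd k)) \<leadsto> ?j (snd k)) (\<lambda>k. ?j (snd k))"
    by (rule discharge) (use p in simp_all)
  have "entails A ?S (\<lambda>k. fst k \<leadsto> ?j (snd k)) (\<lambda>k. ?j (fst k) \<leadsto> ?j (snd k))"
    by (rule entails_trans [OF 1 imp_right [OF 2]]) (use p in simp_all)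
  then show "entails A ?S (\<lambda>(a, b). a \<leadsto> (\<lambda>x \<in> carrier A. ?j x) b)
      (\<lambda>(a, b). (\<lambda>x \<in> carrier A. ?j x) a \<leadsto> (\<lambda>x \<in> carrier A. ?j x) b)"
    by (rule entails_cong; elim SigmaE; simp)
qed simp

lemma entails_log_join_absorb:
  assumes "entails A I (\<lambda>_. e) \<phi>" and c: "\<phi> \<in> I \<rightarrow> carrier A"
  shows "entails A I (\<lambda>i. log_join A (\<phi> i) e) \<phi>"
proof -
  have j: "(\<lambda>i. log_join A (\<phi> i) e) \<in> I \<rightarrow> carrier A"
    using c by (simp add: Pi_iff)
  have "entails A I (\<lambda>i. (\<phi> i \<leadsto> \<phi> i) \<leadsto> (e \<leadsto> \<phi> i) \<leadsto> \<phi> i) (\<lambda>i. (e \<leadsto> \<phi> i) \<leadsto> \<phi> i)"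
    by (rule discharge [OF entails_refl]) (use c in simp_all)
  then have "entails A I (\<lambda>i. log_join A (\<phi> i) e) (\<lambda>i. (e \<leadsto> \<phi> i) \<leadsto> \<phi> i)"
    by (rule entails_trans [OF entails_log_join_elim [OF c c]]) (use c j in simp_all)
  moreover have "entails A I (\<lambda>i. (e \<leadsto> \<phi> i) \<leadsto> \<phi> i) \<phi>"
    by (rule discharge [OF assms(1)]) (use c in simp_all)
  ultimately show ?thesis
    by (rule entails_trans) (use c j in simp_all)
qed

end

end

context binary_implicative
begin

abbreviation c :: "'a \<times> 'a \<Rightarrow> 'a \<times> 'a" where "c \<equiv> c_nucleus A"

lemma bottom_top_closed: "(\<bottom>, \<top>) \<in> carrier Arr"
  by (rule Arr_closedI) (auto intro: bottom_lower)

lemma nucleus_c: "nucleus Arr c"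
  unfolding c_nucleus_def
  by (rule arrow_algebra.log_join_nucleus [OF arrow_algebra_Arr bottom_top_closed])

lemma c_eq: "x \<in> carrier Arr \<Longrightarrow> c x = log_join Arr x (\<bottom>, \<top>)"
  by (simp add: c_nucleus_def)

lemma c_ext: "c \<in> extensional (carrier Arr)"
  by (simp add: c_nucleus_def)

lemma bottom_top_entails_c: "entails Arr (carrier Arr) (\<lambda>_. (\<bottom>, \<top>)) c"
  by (rule entails_cong [OF arrow_algebra.entails_log_join_right [OF arrow_algebra_Arr bottom_top_closed]])
    (simp_all add: c_eq)

lemma c_absorb:
  assumes "entails Arr I (\<lambda>_. (\<bottom>, \<top>)) \<phi>" and c: "\<phi> \<in> I \<rightarrow> carrier Arr"
  shows "entails Arr I (\<lambda>i. c (\<phi> i)) \<phi>"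
  by (rule entails_cong [OF arrow_algebra.entails_log_join_absorb
        [OF arrow_algebra_Arr bottom_top_closed assms]])
    (use c in \<open>auto simp: c_eq Pi_iff\<close>)

end

text \<open>
  This is where modifiability enters: with \<open>\<bottom> \<leadsto> a = \<top>\<close> the lower component of
  \<open>(\<bottom>, \<top>) \<leadsto> x\<close> reduces to \<open>\<top> \<leadsto> x\<^sub>1\<close>, so only the upper component of \<open>x\<close> matters.
\<close>

lemma (in modifiable) bottom_top_entails_iff:
  assumes c: "\<phi> \<in> I \<rightarrow> carrier Arr"
  shows "entails Arr I (\<lambda>_. (\<bottom>, \<top>)) \<phi> \<longleftrightarrow> entails A I (\<lambda>_. \<top>) (\<lambda>i. snd (\<phi> i))"
proof
  assume "entails Arr I (\<lambda>_. (\<bottom>, \<top>)) \<phi>"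
  then have "entails A (I \<times> UNIV) (\<lambda>(i, b). component b (\<bottom>, \<top>)) (\<lambda>(i, b). component b (\<phi> i))"
    by (subst (asm) entails_Arr) (use c bottom_top_closed in simp_all)
  from entails_reindex [OF this, of "\<lambda>i. (i, True)" I]
  show "entails A I (\<lambda>_. \<top>) (\<lambda>i. snd (\<phi> i))"
    by simp
next
  assume "entails A I (\<lambda>_. \<top>) (\<lambda>i. snd (\<phi> i))"
  then obtain r where r: "r \<in> sep A" "\<And>i. i \<in> I \<Longrightarrow> r \<sqsubseteq> \<top> \<leadsto> snd (\<phi> i)"
    unfolding entails_def by blast
  have "r \<sqsubseteq> fst ((\<bottom>, \<top>) \<leadsto>\<^bsub>Arr\<^esub> \<phi> i)" if i: "i \<in> I" for i
  proof -
    have "\<phi> i \<in> carrier Arr"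
      using c i by blast
    then show ?thesis
      using r(1) r(2) [OF i] by (simp add: fst_imp bottom_imp meet_le top_higher)
  qed
  with r show "entails Arr I (\<lambda>_. (\<bottom>, \<top>)) \<phi>"
    unfolding entails_def by (intro bexI [of _ "(r, r)"]) (auto simp: arrow_of_simps(3,5))
qed

locale modifiable_morphism =
  binary_implicative_morphism A B f + A: modifiable A + B: modifiable B
  for A :: "'a arrow_alg" and B :: "'b arrow_alg" and f
begin

text \<open>
  Although \<open>f\<^sup>\<rightarrow>\<close> need not send \<open>(\<bottom>, \<top>)\<close> to \<open>(\<bottom>, \<top>)\<close>, it preserves the families above it, since
  these are the families with a valid upper component.
\<close>

lemma arr_preserves_bottom_top:
  assumes "entails A.Arr I (\<lambda>_. (\<bottom>\<^bsub>A\<^esub>, \<top>\<^bsub>A\<^esub>)) \<phi>" and c: "\<phi> \<in> I \<rightarrow> carrier A.Arr"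
  shows "entails B.Arr I (\<lambda>_. (\<bottom>\<^bsub>B\<^esub>, \<top>\<^bsub>B\<^esub>)) (\<lambda>i. arr (\<phi> i))"
proof -
  interpret h: implicative_morphism A B hull
    by (rule hull_implicative)
  have \<phi>: "\<phi> i \<in> carrier A.Arr" if "i \<in> I" for i
    using c that by blast
  have "entails A I (\<lambda>_. \<top>\<^bsub>A\<^esub>) (\<lambda>i. snd (\<phi> i))"
    using assms by (simp add: A.bottom_top_entails_iff)
  then have "entails B I (\<lambda>_. hull \<top>\<^bsub>A\<^esub>) (\<lambda>i. hull (snd (\<phi> i)))"
    by (rule h.map_entails) (simp_all add: Pi_iff \<phi>)
  then have "entails B I (\<lambda>_. \<top>\<^bsub>B\<^esub>) (\<lambda>i. hull (snd (\<phi> i)))"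
    by (rule B.entails_trans [OF h.map_sep_entails [OF B.top_sep A.top_sep]])
      (simp_all add: Pi_iff \<phi>)
  then have "entails B I (\<lambda>_. \<top>\<^bsub>B\<^esub>) (\<lambda>i. snd (arr (\<phi> i)))"
    by (rule entails_cong) (simp_all add: \<phi> arr_eq)
  then show ?thesis
    by (subst B.bottom_top_entails_iff) (simp_all add: Pi_iff \<phi>)
qed

text \<open>The converse entailment is the unit of the nucleus, so the outer \<open>c\<close> is redundant.\<close>

lemma c_arr_c:
  "entails B.Arr (carrier A.Arr) (\<lambda>x. B.c (arr (A.c x))) (\<lambda>x. arr (A.c x))"
proof (rule B.c_absorb [OF arr_preserves_bottom_top [OF A.bottom_top_entails_c]])
  show "A.c \<in> carrier A.Arr \<rightarrow> carrier A.Arr"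
    using nucleus.j_closed [OF A.nucleus_c] by blast
  then show "(\<lambda>x. arr (A.c x)) \<in> carrier A.Arr \<rightarrow> carrier B.Arr"
    by (simp add: Pi_iff)
qed

end

section \<open>Functoriality of the modification\<close>

context binary_implicative
begin

lemma carrier_modif [simp]: "carrier (modif A) = carrier Arr"
  by (simp add: modif_def nucleus_alg_def)

lemma arrow_algebra_modif: "arrow_algebra (modif A)"
  unfolding modif_def by (rule nucleus.arrow_algebra_nucleus_alg [OF nucleus_c])

lemma c_implicative: "implicative_morphism (modif A) Arr c"
  unfolding modif_def by (rule nucleus.nucleus_implicative [OF nucleus_c c_ext])

lemma id_modif_implicative: "implicative_morphism Arr (modif A) (id_mor Arr)"
  unfolding modif_def by (rule nucleus.id_implicative_nucleus_alg [OF nucleus_c])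

lemma c_closed [simp]: "x \<in> carrier Arr \<Longrightarrow> c x \<in> carrier Arr"
  by (rule nucleus.j_closed [OF nucleus_c])

lemma entails_modif:
  "\<phi> \<in> I \<rightarrow> carrier Arr \<Longrightarrow> \<psi> \<in> I \<rightarrow> carrier Arr
    \<Longrightarrow> entails (modif A) I \<phi> \<psi> \<longleftrightarrow> entails Arr I \<phi> (\<lambda>i. c (\<psi> i))"
  unfolding modif_def by (rule nucleus.entails_nucleus_alg [OF nucleus_c])

lemma entails_Arr_imp_entails_modif:
  "entails Arr I \<phi> \<psi> \<Longrightarrow> \<phi> \<in> I \<rightarrow> carrier Arr \<Longrightarrow> \<psi> \<in> I \<rightarrow> carrier Arr \<Longrightarrow> entails (modif A) I \<phi> \<psi>"
  unfolding modif_def by (rule nucleus.entails_imp_entails_nucleus_alg [OF nucleus_c])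

end

context modifiable_morphism
begin

abbreviation fm :: "'a \<times> 'a \<Rightarrow> 'b \<times> 'b" where "fm \<equiv> modif_mor A B f"

lemma fm_implicative: "implicative_morphism (modif A) (modif B) fm"
  unfolding modif_mor_def
  by (intro compose_implicative [where B = B.Arr] compose_implicative [where B = A.Arr]
      A.c_implicative B.id_modif_implicative arr_implicative)

lemma fm_eq: "x \<in> carrier A.Arr \<Longrightarrow> fm x = arr (A.c x)"
  by (simp add: modif_mor_def compose_eq id_mor_def)

lemma fm_closed [simp]: "x \<in> carrier A.Arr \<Longrightarrow> fm x \<in> carrier B.Arr"
  by (simp add: fm_eq)

lemma c_fm: "entails B.Arr (carrier A.Arr) (\<lambda>x. B.c (fm x)) fm"
  by (rule entails_cong [OF c_arr_c]) (simp_all add: fm_eq)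

lemma fm_c: "entails B.Arr (carrier A.Arr) fm (\<lambda>x. B.c (fm x))"
  by (rule nucleus.entails_unit [OF B.nucleus_c]) auto

end

lemma modifiable_morphismI:
  "modifiable A \<Longrightarrow> modifiable B \<Longrightarrow> implicative_morphism A B f \<Longrightarrow> modifiable_morphism A B f"
  by (simp add: modifiable_morphism_def binary_implicative_morphism_def modifiable_def)

lemma mor_le_modifI:
  assumes "binary_implicative B" "entails (arrow_of B) (carrier A) f g"
    and "f \<in> carrier A \<rightarrow> carrier (arrow_of B)" "g \<in> carrier A \<rightarrow> carrier (arrow_of B)"
  shows "mor_le A (modif B) f g"
proof -
  interpret binary_implicative B by fact
  show ?thesis
    using assms by (simp add: mor_le_entails arrow_algebra_modif entails_Arr_imp_entails_modif)
qed

lemma modif_mor_mono: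
  assumes "modifiable A" "modifiable B" "implicative_morphism A B f" "implicative_morphism A B g"
    and "mor_le A B f g"
  shows "mor_le (modif A) (modif B) (modif_mor A B f) (modif_mor A B g)"
proof -
  interpret f: modifiable_morphism A B f using assms by (intro modifiable_morphismI)
  interpret g: modifiable_morphism A B g using assms by (intro modifiable_morphismI)
  have "entails B (carrier A) f g"
    using assms by (simp add: mor_le_entails f.B.arrow_algebra_axioms f.map_Pi g.map_Pi)
  then have "entails f.B.Arr (carrier f.A.Arr) f.arr g.arr"
    by (intro arrow_mor_mono f.binary_implicative_morphism_axioms g.binary_implicative_morphism_axioms)
  from entails_reindex [OF this, of f.A.c "carrier f.A.Arr"]
  have "entails f.B.Arr (carrier f.A.Arr) f.fm g.fm"
    by (rule entails_cong) (simp_all add: f.fm_eq g.fm_eq)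
  then show ?thesis
    by (intro mor_le_modifI) (auto simp: f.B.binary_implicative_axioms)
qed

lemma modif_mor_id:
  assumes "modifiable A"
  shows "mor_le (modif A) (modif A) (modif_mor A A (id_mor A)) (id_mor (modif A))"
    and "mor_le (modif A) (modif A) (id_mor (modif A)) (modif_mor A A (id_mor A))"
proof -
  interpret modifiable A by fact
  interpret i: modifiable_morphism A A "id_mor A"
    by (intro modifiable_morphismI assms id_mor_implicative arrow_algebra_axioms)
  interpret Arr: arrow_algebra Arr by (rule arrow_algebra_Arr)
  have c: "c \<in> carrier Arr \<rightarrow> carrier Arr"
    by auto
  have id [simp]: "id_mor (modif A) x = x" if "x \<in> carrier Arr" for x
    using that by (simp add: id_mor_def)
  have "entails Arr (carrier Arr) (\<lambda>x. i.arr (c x)) c"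
    by (rule entails_reindex [OF arrow_mor_id(2) [OF binary_implicative_axioms] c])
  then have "entails (modif A) (carrier Arr) i.fm (id_mor (modif A))"
    by (subst entails_modif) (auto simp: i.fm_eq elim!: entails_cong)
  then show "mor_le (modif A) (modif A) i.fm (id_mor (modif A))"
    by (subst mor_le_entails) (auto simp: arrow_algebra_modif)
  have "entails Arr (carrier Arr) (\<lambda>x. x) c"
    by (rule nucleus.j_unit [OF nucleus_c])
  then have "entails Arr (carrier Arr) (\<lambda>x. x) (\<lambda>x. i.arr (c x))"
    by (rule Arr.entails_trans
        [OF _ entails_reindex [OF arrow_mor_id(1) [OF binary_implicative_axioms] c]]) auto
  then have "entails Arr (carrier Arr) (id_mor (modif A)) i.fm"
    by (rule entails_cong) (simp_all add: i.fm_eq)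
  then show "mor_le (modif A) (modif A) (id_mor (modif A)) i.fm"
    by (intro mor_le_modifI) (auto simp: binary_implicative_axioms)
qed

text \<open>
  The composite \<open>g\<^sup>m f\<^sup>m\<close> is \<open>g\<^sup>\<rightarrow> c f\<^sup>\<rightarrow> c\<close>. Since \<open>c f\<^sup>\<rightarrow> c\<close> is isomorphic to \<open>f\<^sup>\<rightarrow> c\<close> and \<open>g\<^sup>\<rightarrow>\<close>
  preserves entailments, it is isomorphic to \<open>g\<^sup>\<rightarrow> f\<^sup>\<rightarrow> c\<close>, already in \<open>C\<^sup>\<rightarrow>\<close>.
\<close>

lemma modif_mor_compose:
  assumes "modifiable A" "modifiable B" "modifiable C"
    and "implicative_morphism A B f" "implicative_morphism B C g"
  shows "mor_le (modif A) (modif C) (modif_mor A C (compose (carrier A) g f))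
      (compose (carrier (modif A)) (modif_mor B C g) (modif_mor A B f))"
    and "mor_le (modif A) (modif C) (compose (carrier (modif A)) (modif_mor B C g) (modif_mor A B f))
      (modif_mor A C (compose (carrier A) g f))"
proof -
  interpret f: modifiable_morphism A B f using assms by (intro modifiable_morphismI)
  interpret g: modifiable_morphism B C g using assms by (intro modifiable_morphismI)
  interpret gf: modifiable_morphism A C "compose (carrier A) g f"
    using assms by (intro modifiable_morphismI compose_implicative [where B = B])
  interpret h: implicative_morphism f.B.Arr g.B.Arr g.arr
    by (rule g.arr_implicative)
  let ?C = "carrier f.A.Arr"
  have c: "f.A.c \<in> ?C \<rightarrow> ?C" "f.fm \<in> ?C \<rightarrow> carrier f.B.Arr"
    "(\<lambda>x. f.arr (f.A.c x)) \<in> ?C \<rightarrow> carrier f.B.Arr"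
    "(\<lambda>x. f.B.c (f.arr (f.A.c x))) \<in> ?C \<rightarrow> carrier f.B.Arr"
    by auto
  note mors = f.binary_implicative_morphism_axioms g.binary_implicative_morphism_axioms
  have 1: "entails g.B.Arr ?C (\<lambda>x. gf.arr (f.A.c x)) (\<lambda>x. g.arr (f.arr (f.A.c x)))"
    and 2: "entails g.B.Arr ?C (\<lambda>x. g.arr (f.arr (f.A.c x))) (\<lambda>x. gf.arr (f.A.c x))"
    by (rule entails_reindex [OF arrow_mor_compose(2) [OF mors] c(1)]
        entails_reindex [OF arrow_mor_compose(1) [OF mors] c(1)])+
  have 3: "entails g.B.Arr ?C (\<lambda>x. g.arr (f.arr (f.A.c x))) (\<lambda>x. g.arr (f.B.c (f.arr (f.A.c x))))"
    by (rule h.map_entails [OF nucleus.entails_unit [OF f.B.nucleus_c c(3)]]) (fact c)+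
  have 4: "entails g.B.Arr ?C (\<lambda>x. g.arr (f.B.c (f.arr (f.A.c x)))) (\<lambda>x. g.arr (f.arr (f.A.c x)))"
    by (rule h.map_entails [OF f.c_arr_c]) (fact c)+
  have "entails g.B.Arr ?C gf.fm (compose ?C g.fm f.fm)"
    by (rule entails_cong [OF h.B.entails_trans [OF 1 3]])
      (auto simp: gf.fm_eq f.fm_eq g.fm_eq compose_eq)
  then show "mor_le (modif A) (modif C) gf.fm (compose (carrier (modif A)) g.fm f.fm)"
    by (intro mor_le_modifI) (auto simp: g.B.binary_implicative_axioms compose_eq)
  have "entails g.B.Arr ?C (compose ?C g.fm f.fm) gf.fm"
    by (rule entails_cong [OF h.B.entails_trans [OF 4 2]])
      (auto simp: gf.fm_eq f.fm_eq g.fm_eq compose_eq)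
  then show "mor_le (modif A) (modif C) (compose (carrier (modif A)) g.fm f.fm) gf.fm"
    by (intro mor_le_modifI) (auto simp: g.B.binary_implicative_axioms compose_eq)
qed

text \<open>
  Formal consequence of the preceding lemmas: \<open>f\<^sup>m h\<^sup>m \<turnstile> (f h)\<^sup>m \<turnstile> id\<^sup>m \<turnstile> id\<close>, and dually for the
  unit.
\<close>

lemma modif_mor_right_adjoint:
  assumes A: "modifiable A" and B: "modifiable B" and f: "implicative_morphism A B f"
    and adj: "right_adjoint A B f h"
  shows "right_adjoint (modif A) (modif B) (modif_mor A B f) (modif_mor B A h)"
proof -
  have h: "implicative_morphism B A h"
    and counit: "mor_le B B (compose (carrier B) f h) (id_mor B)"
    and unit: "mor_le A A (id_mor A) (compose (carrier A) h f)"
    using adj by (simp_all add: right_adjoint_def)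
  interpret f: modifiable_morphism A B f using A B f by (intro modifiable_morphismI)
  interpret h: modifiable_morphism B A h using A B h by (intro modifiable_morphismI)
  have idA: "implicative_morphism A A (id_mor A)" and idB: "implicative_morphism B B (id_mor B)"
    by (simp_all add: id_mor_implicative f.A.arrow_algebra_axioms f.B.arrow_algebra_axioms)
  have fh: "implicative_morphism B B (compose (carrier B) f h)"
    and hf: "implicative_morphism A A (compose (carrier A) h f)"
    using f h by (blast intro: compose_implicative)+
  have m: "implicative_morphism (modif A) (modif A) (id_mor (modif A))"
    "implicative_morphism (modif B) (modif B) (id_mor (modif B))"
    "implicative_morphism (modif A) (modif A) (modif_mor A A (id_mor A))"
    "implicative_morphism (modif B) (modif B) (modif_mor B B (id_mor B))"
    "implicative_morphism (modif B) (modif B) (modif_mor B B (compose (carrier B) f h))"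
    "implicative_morphism (modif A) (modif A) (modif_mor A A (compose (carrier A) h f))"
    using A B idA idB fh hf
    by (simp_all add: id_mor_implicative f.A.arrow_algebra_modif f.B.arrow_algebra_modif
        modifiable_morphismI modifiable_morphism.fm_implicative)
  have mc: "implicative_morphism (modif B) (modif B) (compose (carrier (modif B)) f.fm h.fm)"
    "implicative_morphism (modif A) (modif A) (compose (carrier (modif A)) h.fm f.fm)"
    by (rule compose_implicative; fact f.fm_implicative h.fm_implicative)+
  have "mor_le (modif B) (modif B) (compose (carrier (modif B)) f.fm h.fm) (id_mor (modif B))"
    by (rule mor_le_trans [OF mc(1) m(5) m(2) modif_mor_compose(2) [OF B A B h f]
          mor_le_trans [OF m(5) m(4) m(2) modif_mor_mono [OF B B fh idB counit] modif_mor_id(1) [OF B]]])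
  moreover have "mor_le (modif A) (modif A) (id_mor (modif A)) (compose (carrier (modif A)) h.fm f.fm)"
    by (rule mor_le_trans [OF m(1) m(6) mc(2)
          mor_le_trans [OF m(1) m(3) m(6) modif_mor_id(2) [OF A] modif_mor_mono [OF A A idA hf unit]]
          modif_mor_compose(1) [OF A B A f h]])
  ultimately show ?thesis
    unfolding right_adjoint_def using h.fm_implicative by blast
qed

text \<open>
  On elements the two sides are \<open>c (f\<^sup>\<rightarrow> (c x))\<close> and \<open>f\<^sup>\<rightarrow> (c x)\<close>, so this
  is the redundancy of the outer \<open>c\<close>, stated for morphisms.
\<close>

lemma c_modif_mor_iso:
  assumes "modifiable A" "modifiable B" "implicative_morphism A B f"
  shows "mor_iso (modif A) (arrow_of B)
    (compose (carrier (modif A)) (c_nucleus B) (modif_mor A B f))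
    (compose (carrier (modif A)) (arrow_mor A B f) (c_nucleus A))"
proof -
  interpret modifiable_morphism A B f using assms by (intro modifiable_morphismI)
  let ?l = "compose (carrier (modif A)) B.c fm" and ?r = "compose (carrier (modif A)) arr A.c"
  have impl: "implicative_morphism (modif A) B.Arr ?l" "implicative_morphism (modif A) B.Arr ?r"
    by (rule compose_implicative [OF fm_implicative B.c_implicative]
        compose_implicative [OF A.c_implicative arr_implicative])+
  note Pi = impl [THEN implicative_morphism.map_Pi]
  have "entails B.Arr (carrier A.Arr) ?l ?r" "entails B.Arr (carrier A.Arr) ?r ?l"
    by (rule entails_cong [OF c_fm] entails_cong [OF fm_c]; simp add: compose_eq fm_eq)+
  then have "mor_le (modif A) B.Arr ?l ?r" "mor_le (modif A) B.Arr ?r ?l"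
    unfolding mor_le_entails [OF B.arrow_algebra_Arr Pi] mor_le_entails [OF B.arrow_algebra_Arr Pi(2,1)]
    by simp_all
  with impl show ?thesis
    by (simp add: mor_iso_def)
qed

theorem pseudofunctor_modif:
  "pseudofunctor
     (ArrAlg_mod :: ('u arrow_alg, 'u \<Rightarrow> 'u) pre_cat)
     (ArrAlg :: (('u \<times> 'u) arrow_alg, 'u \<times> 'u \<Rightarrow> 'u \<times> 'u) pre_cat)
     modif modif_mor"
proof -
  have obj: "A \<in> Obj ArrAlg_mod \<longleftrightarrow> modifiable A" for A :: "'u arrow_alg"
    by (auto simp: ArrAlg_mod_def ArrAlg_def full_subcategory_def modifiable_def binary_implicative_def)
  have [simp]: "Hom ArrAlg_mod A B = {f. implicative_morphism A B f}"
    "Hom_le ArrAlg_mod A B = mor_le A B" "Idt ArrAlg_mod A = id_mor A"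
    "Comp ArrAlg_mod A B C = (\<lambda>g f. compose (carrier A) g f)" for A B C :: "'u arrow_alg"
    by (simp_all add: ArrAlg_mod_def ArrAlg_def full_subcategory_def fun_eq_iff)
  have [simp]: "Obj ArrAlg = {A. arrow_algebra A}" "Hom ArrAlg A B = {f. implicative_morphism A B f}"
    "Hom_le ArrAlg A B = mor_le A B" "Idt ArrAlg A = id_mor A"
    "Comp ArrAlg A B C = (\<lambda>g f. compose (carrier A) g f)" for A B C :: "('u \<times> 'u) arrow_alg"
    by (simp_all add: ArrAlg_def fun_eq_iff)
  show ?thesis
  proof (intro pseudofunctor.intro pseudofunctor_axioms.intro preorder_category_ArrAlg)
    show "preorder_category (ArrAlg_mod :: ('u arrow_alg, 'u \<Rightarrow> 'u) pre_cat)"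
      unfolding ArrAlg_mod_def
      by (rule preorder_category_full_subcategory [OF preorder_category_ArrAlg])
  next
    fix A :: "'u arrow_alg" assume "A \<in> Obj ArrAlg_mod"
    then show "modif A \<in> Obj ArrAlg"
      by (simp add: obj binary_implicative.arrow_algebra_modif modifiable.axioms(1))
  qed (simp_all add: obj hom_iso_def modif_mor_mono modif_mor_id modif_mor_compose
      modifiable_morphism.fm_implicative modifiable_morphismI)
qed

theorem theorem8p15:
  shows "pseudofunctor
           (ArrAlg_mod :: ('u arrow_alg, 'u \<Rightarrow> 'u) pre_cat)
           (ArrAlg :: (('u \<times> 'u) arrow_alg, 'u \<times> 'u \<Rightarrow> 'u \<times> 'u) pre_cat)
           modif modif_mor
       \<and> (\<forall>(A :: 'a arrow_alg) (B :: 'b arrow_alg) f h.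
            modifiable A \<and> modifiable B \<and> implicative_morphism A B f \<and> right_adjoint A B f h \<longrightarrow>
              computationally_dense (modif A) (modif B) (modif_mor A B f)
            \<and> right_adjoint (modif A) (modif B) (modif_mor A B f) (modif_mor B A h)
            \<and> mor_iso (modif B) (arrow_of A)
                (compose (carrier (modif B)) (c_nucleus A) (modif_mor B A h))
                (compose (carrier (modif B)) (arrow_mor B A h) (c_nucleus B)))"
proof (intro conjI allI impI; (elim conjE)?)
  fix A :: "'a arrow_alg" and B :: "'b arrow_alg" and f h
  assume A: "modifiable A" and B: "modifiable B" and f: "implicative_morphism A B f"
    and adj: "right_adjoint A B f h"
  show ra: "right_adjoint (modif A) (modif B) (modif_mor A B f) (modif_mor B A h)"
    by (rule modif_mor_right_adjoint [OF A B f adj])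
  show "computationally_dense (modif A) (modif B) (modif_mor A B f)"
    unfolding computationally_dense_def
    using ra modifiable_morphism.fm_implicative [OF modifiable_morphismI [OF A B f]] by blast
  show "mor_iso (modif B) (arrow_of A)
      (compose (carrier (modif B)) (c_nucleus A) (modif_mor B A h))
      (compose (carrier (modif B)) (arrow_mor B A h) (c_nucleus B))"
    using c_modif_mor_iso [OF B A] adj by (simp add: right_adjoint_def)
qed (rule pseudofunctor_modif)

end
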